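(* Let $p_0,p_1,p_2\ge0$ with $p:=p_0+p_1+p_2\in(0,1]$, let $(B_0,B_1,B_2)$ be the multinomial process with parameters $p_0,p_1,p_2$, and let $$S_1(t)=\sum_{i=0}^{B_1(t)}Y_{1i}+\sum_{i=0}^{B_0(t)}Y_{3i},\qquad S_2(t)=\sum_{i=0}^{B_2(t)}Y_{2i}+\sum_{i=0}^{B_0(t)}Y_{4i},\qquad t=0,1,\dots,$$ with claim sizes $Y_{ki}$ as described in the context. Then the bivariate process $(S_1,S_2)$ is a bivariate compound binomial process of type I. More precisely, it has the same finite dimensional distributions as the process $(S_3,S_4)$, where, for $t=0,1,\dots$, $$S_3(t)=\sum_{n=0}^{B(t)}(I_{1n}Y_{1n}+I_{0n}Y_{3n}),\qquad S_4(t)=\sum_{n=0}^{B(t)}(I_{2n}Y_{2n}+I_{0n}Y_{4n}),$$ and also as the process $$\left(\sum_{n=0}^{t}I_{A_n}(I_{1n}Y_{1n}+I_{0n}Y_{3n}),\ \sum_{n=0}^{t}I_{A_n}(I_{2n}Y_{2n}+I_{0n}Y_{4n})\right),\qquad t=0,1,\dots.$$ Here $Y_{k0}=0$ for $k=1,2,3,4$ (so the $n=0$ terms vanish); the vectors $(I_{1i},I_{2i},I_{0i})$, $i\ge1$, are i.i.d. and take the values $(1,0,0),(0,1,0),(0,0,1)$ with probabilities $\frac{p_1}{p},\frac{p_2}{p},\frac{p_0}{p}$ respectively; $B$ is a homogeneous Binomial process with independent additive increments and parameter $p$; $I_{A_i}$, $i\ge1$, are i.i.d. Bernoulli random variables with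 parameter $\mathbb{P}(A_i)=p$; and the families $\{I_{A_i}\}_{i\ge1}$, $B$, $\{Y_{1i}\}_{i\ge1}$, $\{Y_{2i}\}_{i\ge1}$, $\{(Y_{3i},Y_{4i})\}_{i\ge1}$ and $\{(I_{1i},I_{2i},I_{0i})\}_{i\ge1}$ are mutually independent.
   Context: The multinomial process with parameters $p_0,p_1,p_2$ is the discrete time process $(B_0,B_1,B_2)$ starting at $(0,0,0)$, with independent and homogeneous (stationary) additive increments, whose one-time distributions are $$\mathbb{P}(B_0(t)=b_0,B_1(t)=b_1,B_2(t)=b_2)=\frac{t!}{b_0!\,b_1!\,b_2!\,(t-b_0-b_1-b_2)!}p_0^{b_0}p_1^{b_1}p_2^{b_2}(1-p)^{t-b_0-b_1-b_2}$$ for $b_0,b_1,b_2\in\{0,\dots,t\}$ with $b_0+b_1+b_2\le t$, and $0$ otherwise. A homogeneous Binomial process with parameter $p$ is a process $B$ with $B(0)=0$ and independent stationary increments such that $B(t)$ has the Binomial$(t,p)$ distribution. Claim sizes: the $Y_{ki}$ ($k=1,2,3,4$, $i\ge1$) are integer-valued with $\mathbb{P}(Y_{ki}>0)=1$; $\{Y_{1i}\}_{i\ge1}$ are i.i.d., $\{Y_{2i}\}_{i\ge1}$ are i.i.d., the pairs $\{(Y_{3i},Y_{4i})\}_{i\ge1}$ are i.i.d. ($Y_{3i}$ and $Y_{4i}$ may be dependent); these three sequences are mutually independent and independent of $(B_0,B_1,B_2)$; $Y_{k0}=0$. A bivariate compound binomial process of type I is a process with the same finite dimensional distributions as $\left(\sum_{n=1}^{N(t)}X_{1n},\sum_{n=1}^{N(t)}X_{2n}\right)$,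 $t=0,1,\dots$, where $N$ is a homogeneous Binomial process independent of the i.i.d. pairs $(X_{1n},X_{2n})$, $n\ge1$ (equal number of summands in both coordinates). *)

theory Defs
  imports "HOL-Probability.Probability"
begin

text \<open>
  All random variables below take values in countable types, which carry the discrete
  \<open>\<sigma>\<close>-algebra \<open>count_space UNIV\<close>.  A process or sequence is a function of
  type \<open>nat \<Rightarrow> 'a \<Rightarrow> 'v\<close>.
\<close>

definition iid :: "'a measure \<Rightarrow> (nat \<Rightarrow> 'a \<Rightarrow> 'v) \<Rightarrow> bool" where
  "iid M X \<longleftrightarrow>
     prob_space.indep_vars M (\<lambda>_. count_space UNIV) X {1..} \<and>
     (\<forall>i\<ge>1. distr M (count_space UNIV) (X i) = distr M (count_space UNIV) (X 1))"

text \<open>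
  The families whose independence is asserted have different value types, so \<open>indep_vars\<close>
  does not apply to them directly; as in its definition, independence is expressed by
  \<open>indep_sets\<close> for the generated \<open>\<sigma>\<close>-algebras.
\<close>

definition gen_sigma :: "'a measure \<Rightarrow> nat set \<Rightarrow> (nat \<Rightarrow> 'a \<Rightarrow> 'v) \<Rightarrow> 'a set set" where
  "gen_sigma M J X = sigma_sets (space M) {X i -` C \<inter> space M | i C. i \<in> J}"

definition mutually_indep :: "'a measure \<Rightarrow> 'a set set list \<Rightarrow> bool" where
  "mutually_indep M Fs \<longleftrightarrow> prob_space.indep_sets M (\<lambda>k. Fs ! k) {..<length Fs}"

definition independent_increments ::
    "'a measure \<Rightarrow> (nat \<Rightarrow> 'a \<Rightarrow> 'v::ab_group_add) \<Rightarrow> bool" where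
  "independent_increments M X \<longleftrightarrow>
     (\<forall>n t. strict_mono t \<longrightarrow>
        prob_space.indep_vars M (\<lambda>_. count_space UNIV)
          (\<lambda>k \<omega>. X (t (Suc k)) \<omega> - X (t k) \<omega>) {..<n})"

definition stationary_increments ::
    "'a measure \<Rightarrow> (nat \<Rightarrow> 'a \<Rightarrow> 'v::ab_group_add) \<Rightarrow> bool" where
  "stationary_increments M X \<longleftrightarrow>
     (\<forall>s t. distr M (count_space UNIV) (\<lambda>\<omega>. X (s + t) \<omega> - X s \<omega>) =
            distr M (count_space UNIV) (\<lambda>\<omega>. X t \<omega> - X 0 \<omega>))"

text \<open>
  The counting processes are \<open>nat\<close>-valued; they are cast to \<open>int\<close> in the increments because
  subtraction on \<open>nat\<close> truncates.
\<close>

definition multinomial_process ::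
    "'a measure \<Rightarrow> real \<Rightarrow> real \<Rightarrow> real \<Rightarrow>
     (nat \<Rightarrow> 'a \<Rightarrow> nat) \<Rightarrow> (nat \<Rightarrow> 'a \<Rightarrow> nat) \<Rightarrow> (nat \<Rightarrow> 'a \<Rightarrow> nat) \<Rightarrow> bool" where
  "multinomial_process M p0 p1 p2 B0 B1 B2 \<longleftrightarrow>
     (\<forall>t. B0 t \<in> measurable M (count_space UNIV) \<and>
          B1 t \<in> measurable M (count_space UNIV) \<and>
          B2 t \<in> measurable M (count_space UNIV)) \<and>
     (AE \<omega> in M. B0 0 \<omega> = 0 \<and> B1 0 \<omega> = 0 \<and> B2 0 \<omega> = 0) \<and>
     independent_increments M (\<lambda>t \<omega>. (int (B0 t \<omega>), int (B1 t \<omega>), int (B2 t \<omega>))) \<and>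
     stationary_increments M (\<lambda>t \<omega>. (int (B0 t \<omega>), int (B1 t \<omega>), int (B2 t \<omega>))) \<and>
     (\<forall>t b0 b1 b2.
        measure M {\<omega> \<in> space M. B0 t \<omega> = b0 \<and> B1 t \<omega> = b1 \<and> B2 t \<omega> = b2} =
          (if b0 + b1 + b2 \<le> t
           then fact t / (fact b0 * fact b1 * fact b2 * fact (t - b0 - b1 - b2)) *
                p0 ^ b0 * p1 ^ b1 * p2 ^ b2 * (1 - (p0 + p1 + p2)) ^ (t - b0 - b1 - b2)
           else 0))"

definition binomial_process :: "'a measure \<Rightarrow> real \<Rightarrow> (nat \<Rightarrow> 'a \<Rightarrow> nat) \<Rightarrow> bool" where
  "binomial_process M p B \<longleftrightarrow>
     0 \<le> p \<and> p \<le> 1 \<and>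
     (\<forall>t. B t \<in> measurable M (count_space UNIV)) \<and>
     (AE \<omega> in M. B 0 \<omega> = 0) \<and>
     independent_increments M (\<lambda>t \<omega>. int (B t \<omega>)) \<and>
     stationary_increments M (\<lambda>t \<omega>. int (B t \<omega>)) \<and>
     (\<forall>t. distr M (count_space UNIV) (B t) = measure_pmf (binomial_pmf t p))"

definition claim_sizes :: "'a measure \<Rightarrow> (nat \<Rightarrow> nat \<Rightarrow> 'a \<Rightarrow> int) \<Rightarrow> bool" where
  "claim_sizes M Y \<longleftrightarrow>
     (\<forall>k\<in>{1..4}. \<forall>\<omega>\<in>space M. Y k 0 \<omega> = 0) \<and>
     (\<forall>k\<in>{1..4}. \<forall>i\<ge>1. Y k i \<in> measurable M (count_space UNIV) \<and>
        measure M {\<omega> \<in> space M. Y k i \<omega> > 0} = 1) \<and>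
     iid M (Y 1) \<and> iid M (Y 2) \<and> iid M (\<lambda>i \<omega>. (Y 3 i \<omega>, Y 4 i \<omega>))"

definition same_claim_laws ::
    "'a measure \<Rightarrow> (nat \<Rightarrow> nat \<Rightarrow> 'a \<Rightarrow> int) \<Rightarrow>
     'b measure \<Rightarrow> (nat \<Rightarrow> nat \<Rightarrow> 'b \<Rightarrow> int) \<Rightarrow> bool" where
  "same_claim_laws M Y M' Y' \<longleftrightarrow>
     (\<forall>i\<ge>1.
        distr M (count_space UNIV) (Y 1 i) = distr M' (count_space UNIV) (Y' 1 i) \<and>
        distr M (count_space UNIV) (Y 2 i) = distr M' (count_space UNIV) (Y' 2 i) \<and>
        distr M (count_space UNIV) (\<lambda>\<omega>. (Y 3 i \<omega>, Y 4 i \<omega>)) =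
          distr M' (count_space UNIV) (\<lambda>\<omega>. (Y' 3 i \<omega>, Y' 4 i \<omega>)))"

definition indicator_vectors ::
    "'a measure \<Rightarrow> real \<Rightarrow> real \<Rightarrow> real \<Rightarrow> (nat \<Rightarrow> nat \<Rightarrow> 'a \<Rightarrow> int) \<Rightarrow> bool" where
  "indicator_vectors M p0 p1 p2 I \<longleftrightarrow>
     iid M (\<lambda>i \<omega>. (I 1 i \<omega>, I 2 i \<omega>, I 0 i \<omega>)) \<and>
     (\<forall>i\<ge>1.
        measure M {\<omega> \<in> space M. (I 1 i \<omega>, I 2 i \<omega>, I 0 i \<omega>) = (1, 0, 0)} = p1 / (p0 + p1 + p2) \<and>
        measure M {\<omega> \<in> space M. (I 1 i \<omega>, I 2 i \<omega>, I 0 i \<omega>) = (0, 1, 0)} = p2 / (p0 + p1 + p2) \<and>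
        measure M {\<omega> \<in> space M. (I 1 i \<omega>, I 2 i \<omega>, I 0 i \<omega>) = (0, 0, 1)} = p0 / (p0 + p1 + p2))"

definition bernoulli_events :: "'a measure \<Rightarrow> real \<Rightarrow> (nat \<Rightarrow> 'a set) \<Rightarrow> bool" where
  "bernoulli_events M p A \<longleftrightarrow>
     (\<forall>i\<ge>1. A i \<in> sets M \<and> measure M (A i) = p) \<and>
     iid M (\<lambda>i. indicator (A i) :: 'a \<Rightarrow> int)"

text \<open>
  Measurability is part of the definition because \<open>distr\<close> is meaningless for non-measurable maps.
\<close>

definition same_fdd ::
    "'a measure \<Rightarrow> (nat \<Rightarrow> 'a \<Rightarrow> 'v) \<Rightarrow> 'b measure \<Rightarrow> (nat \<Rightarrow> 'b \<Rightarrow> 'v) \<Rightarrow> bool" where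
  "same_fdd M X M' X' \<longleftrightarrow>
     (\<forall>t. X t \<in> measurable M (count_space UNIV)) \<and>
     (\<forall>t. X' t \<in> measurable M' (count_space UNIV)) \<and>
     (\<forall>J. finite J \<longrightarrow>
        distr M (\<Pi>\<^sub>M t\<in>J. count_space UNIV) (\<lambda>\<omega>. \<lambda>t\<in>J. X t \<omega>) =
        distr M' (\<Pi>\<^sub>M t\<in>J. count_space UNIV) (\<lambda>\<omega>. \<lambda>t\<in>J. X' t \<omega>))"

text \<open>
  HOL cannot quantify over the type of the sample space of \<open>N\<close>, \<open>X1\<close>, \<open>X2\<close>.  Taking it to be the
  type of paths of \<open>(N, (X1, X2))\<close> loses no generality: all conditions depend only on the joint law
  of \<open>N\<close>, \<open>X1\<close>, \<open>X2\<close>, so any such triple can be replaced by the coordinate maps under that law.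
\<close>

definition compound_binomial_type_I ::
    "'a measure \<Rightarrow> (nat \<Rightarrow> 'a \<Rightarrow> int \<times> int) \<Rightarrow> bool" where
  "compound_binomial_type_I M S \<longleftrightarrow>
     (\<exists>(Q :: ((nat \<Rightarrow> nat) \<times> (nat \<Rightarrow> int \<times> int)) measure) q N X1 X2.
        prob_space Q \<and>
        binomial_process Q q N \<and>
        iid Q (\<lambda>n \<omega>. (X1 n \<omega>, X2 n \<omega>)) \<and>
        mutually_indep Q
          [gen_sigma Q UNIV N, gen_sigma Q {1..} (\<lambda>n \<omega>. (X1 n \<omega>, X2 n \<omega>))] \<and>
        same_fdd M S Q
          (\<lambda>t \<omega>. (\<Sum>n=1..N t \<omega>. X1 n \<omega>, \<Sum>n=1..N t \<omega>. X2 n \<omega>)))"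

end

theory Submission
  imports Defs
begin

text \<open>
  Each of the three processes is, almost surely on \<open>{0..n}\<close>, a random walk with independent steps
  of one common law.  A unit step of the multinomial process is the zero vector or one of the three
  unit vectors; at a step of type \<open>k\<close> the process consumes the next unused claims of that type.
  The index of the next unused claim is an injective function of the step number that is determined
  by the counting process, and injectively relabelling an i.i.d. sequence by an independent random
  choice leaves its law unchanged, so that step \<open>i\<close> may be regarded as consuming a fresh claim.
  The same relabelling treats sums up to a binomial time.  The step laws agree because a step of
  the multinomial process is an independent product of a Bernoulli variable and an indicator vector.
\<close>

text \<open>The obstacle is that claims are read at random indices: the \<open>j\<close>-th claim of
  a type is used at the random time of the \<open>j\<close>-th event of that type. The relabelling
  needs an index for every step, also for steps that consume nothing. For a fixed horizon
  \<open>n\<close> such steps receive claims with indices beyond \<open>n\<close>, which no step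
  within the horizon consumes, and multiply them by 0. This choice depends on \<open>n\<close>, so
  steps are represented for one horizon at a time, which suffices for finite dimensional
  distributions. The claim families are attached one after another, and the enlarged steps must stay
  independent of the families not yet used; hence steps are always considered together with a
  sigma-algebra. As values are countable, laws are handled through point probabilities. In the
  multinomial process each claim type has a clock of its own, whereas the marked processes read the
  mark and all claims at one common index. Only the law of a single step matters in the end, so this
  difference disappears, and an identity of pmfs remains that rests on
  \<open>p1 = p * (p1 / p)\<close> and its analogues.\<close>

section \<open>Laws of discrete random variables\<close>

lemma (in prob_space) distr_eq_pmf:
  fixes X :: "'a \<Rightarrow> 'v::countable"
  assumes X: "X \<in> measurable M (count_space UNIV)"
  obtains q where "distr M (count_space UNIV) X = measure_pmf q"
proof -
  let ?D = "distr M (count_space UNIV) X"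
  interpret D: prob_space ?D
    using X by (rule prob_space_distr)
  \<comment> \<open>Countability of the type makes the set of all points without mass a null set,
    which is the essential condition for a probability measure to be a pmf.\<close>
  have "(\<Union>x\<in>{x. measure ?D {x} = 0}. {x}) \<in> null_sets ?D"
    by (intro null_sets_UN') (auto simp: null_sets_def D.emeasure_eq_measure)
  then have "AE x in ?D. measure ?D {x} \<noteq> 0"
    by (rule AE_I') auto
  then have "measure_pmf (Abs_pmf ?D) = ?D"
    by (intro Abs_pmf_inverse) (auto intro: D.prob_space_axioms)
  then show thesis
    using that by metis
qed

lemma (in prob_space) prob_eq_pmf:
  assumes "X \<in> measurable M (count_space UNIV)"
    and "distr M (count_space UNIV) X = measure_pmf q"
  shows "prob {\<omega> \<in> space M. X \<omega> \<in> A} = measure_pmf.prob q A"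
  using measure_distr[OF assms(1), of A] assms(2)
  by (simp add: vimage_def Int_def conj_commute)

lemma (in prob_space) pmf_eq_prob:
  assumes "X \<in> measurable M (count_space UNIV)"
    and "distr M (count_space UNIV) X = measure_pmf q"
  shows "pmf q x = prob {\<omega> \<in> space M. X \<omega> = x}"
  using prob_eq_pmf[OF assms, of "{x}"] by (simp add: pmf.rep_eq)

section \<open>Generated sigma-algebras and mutual independence\<close>

lemma sigma_algebra_gen_sigma: "sigma_algebra (space M) (gen_sigma M J X)"
  unfolding gen_sigma_def by (rule sigma_algebra_sigma_sets) auto

lemma gen_sigma_event:
  assumes "i \<in> J"
  shows "{\<omega> \<in> space M. P (X i \<omega>)} \<in> gen_sigma M J X"
proof -
  have "{\<omega> \<in> space M. P (X i \<omega>)} = X i -` Collect P \<inter> space M"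
    by auto
  then show ?thesis
    unfolding gen_sigma_def using assms by (intro sigma_sets.Basic) blast
qed

lemma gen_sigma_least:
  assumes "sigma_algebra (space M) F"
    and "\<And>i C. i \<in> J \<Longrightarrow> {\<omega> \<in> space M. X i \<omega> \<in> C} \<in> F"
  shows "gen_sigma M J X \<subseteq> F"
proof -
  have "X i -` C \<inter> space M \<in> F" if "i \<in> J" for i C
  proof -
    have "X i -` C \<inter> space M = {\<omega> \<in> space M. X i \<omega> \<in> C}"
      by auto
    then show ?thesis
      using assms(2)[OF that] by simp
  qed
  then show ?thesis
    unfolding gen_sigma_def by (intro sigma_algebra.sigma_sets_subset[OF assms(1)]) auto
qed

lemma gen_sigma_comp: "gen_sigma M J (\<lambda>i \<omega>. f (X i \<omega>)) \<subseteq> gen_sigma M J X"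
  by (intro gen_sigma_least sigma_algebra_gen_sigma gen_sigma_event)

lemma (in prob_space) gen_sigma_events:
  assumes "\<And>i. i \<in> J \<Longrightarrow> X i \<in> measurable M (count_space UNIV)"
  shows "gen_sigma M J X \<subseteq> events"
proof (intro gen_sigma_least sets.sigma_algebra_axioms)
  fix i C assume "i \<in> J"
  from measurable_sets[OF assms[OF this], of C] show "{\<omega> \<in> space M. X i \<omega> \<in> C} \<in> events"
    by (simp add: vimage_def Int_def conj_commute)
qed

text \<open>Serves to reorder, omit and shrink independent families at once. Injectivity of
  \<open>f\<close> keeps a family from being used twice and turns the product over the indices into
  the product over their images.\<close>

lemma (in prob_space) mutually_indep_reindex:
  assumes ind: "mutually_indep M Fs"
    and f: "inj_on f {..<length Gs}"
    and sub: "\<And>k. k < length Gs \<Longrightarrow> f k < length Fs \<and> Gs ! k \<subseteq> Fs ! f k"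
  shows "mutually_indep M Gs"
  unfolding mutually_indep_def
proof (intro indep_setsI)
  have Fs: "indep_sets (\<lambda>k. Fs ! k) {..<length Fs}"
    using ind by (simp add: mutually_indep_def)
  then have ev: "Fs ! k \<subseteq> events" if "k < length Fs" for k
    using that by (auto simp: indep_sets_def)
  show "Gs ! i \<subseteq> events" if "i \<in> {..<length Gs}" for i
    using ev[of "f i"] sub[of i] that by auto
  fix A J
  assume J: "J \<noteq> {}" "J \<subseteq> {..<length Gs}" "finite J" and A: "\<forall>j\<in>J. A j \<in> Gs ! j"
  have inj: "inj_on f J"
    using f J(2) by (rule inj_on_subset)
  let ?A = "\<lambda>k. A (inv_into J f k)"
  have "prob (\<Inter>k\<in>f ` J. ?A k) = (\<Prod>k\<in>f ` J. prob (?A k))"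
  proof (rule indep_setsD[OF Fs])
    show "f ` J \<subseteq> {..<length Fs}" "f ` J \<noteq> {}" "finite (f ` J)"
      using J sub by auto
    show "\<forall>k\<in>f ` J. ?A k \<in> Fs ! k"
      using A sub J(2) inj by (auto simp: inv_into_f_f subset_iff)
  qed
  then show "prob (\<Inter>j\<in>J. A j) = (\<Prod>j\<in>J. prob (A j))"
    using inj by (simp add: prod.reindex inv_into_f_f)
qed

lemma (in prob_space) mutually_indep_prob_Int:
  assumes "mutually_indep M (F # G # Fs)" and "E \<in> F" and "H \<in> G"
  shows "prob (E \<inter> H) = prob E * prob H"
proof -
  have ind: "indep_sets (\<lambda>k. (F # G # Fs) ! k) {..<length (F # G # Fs)}"
    using assms(1) by (simp add: mutually_indep_def)
  have "prob (\<Inter>j\<in>{0, 1::nat}. if j = 0 then E else H) =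
    (\<Prod>j\<in>{0, 1::nat}. prob (if j = 0 then E else H))"
    by (rule indep_setsD[OF ind]) (use assms in auto)
  then show ?thesis
    by (simp add: Int_commute)
qed

text \<open>Once a family is absorbed into the steps, the enlarged steps must remain independent of
  the rest. Sigma-algebras are closed under intersection, so grouping the indices into disjoint
  blocks preserves independence of what the blocks generate.\<close>

lemma (in prob_space) mutually_indep_merge:
  assumes ind: "mutually_indep M (F # G # Fs)"
    and sig: "\<And>H. H \<in> set (F # G # Fs) \<Longrightarrow> sigma_algebra (space M) H"
  shows "mutually_indep M (sigma_sets (space M) (F \<union> G) # Fs)"
proof -
  let ?E = "\<lambda>k. (F # G # Fs) ! k"
  \<comment> \<open>Block 0 collects the two merged families; every later block is a single index,
    shifted by one because the list becomes shorter.\<close>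
  let ?I = "\<lambda>j. if j = 0 then {0, 1} else {Suc j}"
  have 1: "(\<Union>j\<in>{..<Suc (length Fs)}. ?I j) \<subseteq> {..<length (F # G # Fs)}"
    by (auto split: if_splits)
  have "indep_sets (\<lambda>j. sigma_sets (space M) (\<Union>i\<in>?I j. ?E i)) {..<Suc (length Fs)}"
  proof (rule indep_sets_collect_sigma)
    show "indep_sets ?E (\<Union>j\<in>{..<Suc (length Fs)}. ?I j)"
      using ind indep_sets_mono_index[OF 1] by (simp add: mutually_indep_def)
    show "disjoint_family_on ?I {..<Suc (length Fs)}"
      by (auto simp: disjoint_family_on_def)
    fix i j assume "j \<in> {..<Suc (length Fs)}" "i \<in> ?I j"
    then have "?E i \<in> set (F # G # Fs)"
      using 1 by (intro nth_mem) blast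
    then show "Int_stable (?E i)"
      using sig sigma_algebra.axioms(1) algebra.axioms(1) ring_of_sets.axioms(1)
        semiring_of_sets.Int by (metis Int_stableI)
  qed
  then show ?thesis
    unfolding mutually_indep_def
  proof (rule indep_sets_mono)
    fix i assume i: "i \<in> {..<length (sigma_sets (space M) (F \<union> G) # Fs)}"
    show "(sigma_sets (space M) (F \<union> G) # Fs) ! i \<subseteq> sigma_sets (space M) (\<Union>i\<in>?I i. ?E i)"
      by (cases i) (auto intro: sigma_sets.Basic)
  qed auto
qed

section \<open>Finite sequences of independent steps with a common law\<close>

lemma (in prob_space) iid_measurable:
  assumes "iid M X" "i \<ge> 1"
  shows "X i \<in> measurable M (count_space UNIV)"
  using assms by (auto simp: iid_def indep_vars_def)

text \<open>Injectivity makes the selected variables distinct members of the independent sequence,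
  and they all have the common law. The case \<open>n = 0\<close> is separate since independence
  speaks only of nonempty index sets.\<close>

lemma (in prob_space) iid_reindex_prob:
  assumes iid: "iid M X" and law: "distr M (count_space UNIV) (X 1) = measure_pmf q"
    and \<psi>: "inj_on \<psi> {1..n::nat}" "\<And>i. i \<in> {1..n} \<Longrightarrow> \<psi> i \<ge> 1"
  shows "prob {\<omega> \<in> space M. \<forall>i\<in>{1..n}. X (\<psi> i) \<omega> = x i} = (\<Prod>i=1..n. pmf q (x i))"
proof (cases "n = 0")
  case True
  then show ?thesis
    by (simp add: prob_space)
next
  case False
  have ind: "indep_vars (\<lambda>_. count_space UNIV) X {1..}"
    using iid by (simp add: iid_def)
  \<comment> \<open>The prescribed values are indexed by \<open>i\<close>, independence by
    \<open>j = \<psi> i\<close>; the inverse of \<open>\<psi>\<close> translates between the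
    two.\<close>
  let ?A = "\<lambda>j. {x (inv_into {1..n} \<psi> j)}"
  have "prob (\<Inter>j\<in>\<psi> ` {1..n}. X j -` ?A j \<inter> space M) =
    (\<Prod>j\<in>\<psi> ` {1..n}. prob (X j -` ?A j \<inter> space M))"
    by (rule indep_varsD[OF ind]) (use False \<psi> in auto)
  also have "\<dots> = (\<Prod>i=1..n. prob (X (\<psi> i) -` {x i} \<inter> space M))"
    using \<psi>(1) by (simp add: prod.reindex)
  also have "\<dots> = (\<Prod>i=1..n. pmf q (x i))"
  proof (rule prod.cong[OF refl])
    fix i assume "i \<in> {1..n}"
    then have i: "\<psi> i \<ge> 1"
      by (rule \<psi>(2))
    then have "distr M (count_space UNIV) (X (\<psi> i)) = measure_pmf q"
      using iid law unfolding iid_def by metis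
    from pmf_eq_prob[OF iid_measurable[OF iid i] this, of "x i"]
    show "prob (X (\<psi> i) -` {x i} \<inter> space M) = pmf q (x i)"
      by (simp add: vimage_def Int_def conj_commute)
  qed
  also have "(\<Inter>j\<in>\<psi> ` {1..n}. X j -` ?A j \<inter> space M) =
    {\<omega> \<in> space M. \<forall>i\<in>{1..n}. X (\<psi> i) \<omega> = x i}"
    using False \<psi>(1) by (auto simp: inv_into_f_f)
  finally show ?thesis .
qed

lemma sigma_algebra_Collect_finite_Ball:
  assumes "sigma_algebra S F" and "finite I" and "\<And>i. i \<in> I \<Longrightarrow> {\<omega> \<in> S. P i \<omega>} \<in> F"
  shows "{\<omega> \<in> S. \<forall>i\<in>I. P i \<omega>} \<in> F"
proof -
  interpret sigma_algebra S F by fact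
  show ?thesis
    using assms(2,3) by (intro sets_Collect_finite_All)
qed

text \<open>\<open>F\<close> records the events that the steps may use, so that independence from
  other families can be expressed through \<open>F\<close>. For countable value types the point
  probabilities determine the joint law; indices outside \<open>{1..n}\<close> are
  unconstrained.\<close>

definition iid_steps ::
    "'a measure \<Rightarrow> 'a set set \<Rightarrow> nat \<Rightarrow> (nat \<Rightarrow> 'a \<Rightarrow> 'w) \<Rightarrow> 'w pmf \<Rightarrow> bool" where
  "iid_steps M F n W w \<longleftrightarrow>
     (\<forall>i\<in>{1..n}. \<forall>x. {\<omega> \<in> space M. W i \<omega> = x} \<in> F) \<and>
     (\<forall>x. measure M {\<omega> \<in> space M. \<forall>i\<in>{1..n}. W i \<omega> = x i} = (\<Prod>i=1..n. pmf w (x i)))"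

lemma iid_steps_mono: "iid_steps M F n W w \<Longrightarrow> F \<subseteq> G \<Longrightarrow> iid_steps M G n W w"
  by (auto simp: iid_steps_def)

lemma (in prob_space) iid_steps_reindex:
  assumes "iid M X" and "distr M (count_space UNIV) (X 1) = measure_pmf q"
    and "inj_on \<psi> {1..n}" "\<And>i. i \<in> {1..n} \<Longrightarrow> \<psi> i \<ge> 1"
  shows "iid_steps M (gen_sigma M {1..} X) n (\<lambda>i. X (\<psi> i)) q"
  unfolding iid_steps_def
proof (intro conjI ballI allI)
  fix i x assume "i \<in> {1..n}"
  then show "{\<omega> \<in> space M. X (\<psi> i) \<omega> = x} \<in> gen_sigma M {1..} X"
    using assms(4) by (intro gen_sigma_event) simp
qed (rule iid_reindex_prob[OF assms])

lemma (in prob_space) iid_steps_iid: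
  assumes "iid M X" and "distr M (count_space UNIV) (X 1) = measure_pmf q"
  shows "iid_steps M (gen_sigma M {1..} X) n X q"
  using iid_steps_reindex[OF assms, of "\<lambda>i. i"] by auto

lemma pmf_pair_prod: "pmf (pair_pmf p q) z = pmf p (fst z) * pmf q (snd z)"
  by (cases z) (simp add: pmf_pair)

text \<open>
  Given the values of \<open>W\<close>, the family \<open>X\<close> is only relabelled injectively, which changes
  neither its law nor its independence of \<open>W\<close>.
\<close>

lemma (in prob_space) iid_steps_pair:
  fixes W :: "nat \<Rightarrow> 'a \<Rightarrow> 'w::countable" and X :: "nat \<Rightarrow> 'a \<Rightarrow> 'v"
  assumes ind: "mutually_indep M (F # gen_sigma M {1..} X # Fs)"
    and F: "sigma_algebra (space M) F"
    and W: "iid_steps M F n W w"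
    and X: "iid M X" "distr M (count_space UNIV) (X 1) = measure_pmf q"
    and inj: "\<And>z. inj_on (\<psi> z) {1..n}" and range: "\<And>z i. i \<in> {1..n} \<Longrightarrow> \<psi> z i \<ge> 1"
    and cong: "\<And>z z' i. (\<And>i. i \<in> {1..n} \<Longrightarrow> z i = z' i) \<Longrightarrow> i \<in> {1..n} \<Longrightarrow> \<psi> z i = \<psi> z' i"
  shows "iid_steps M (sigma_sets (space M) (F \<union> gen_sigma M {1..} X)) n
    (\<lambda>i \<omega>. (W i \<omega>, X (\<psi> (\<lambda>j. W j \<omega>) i) \<omega>)) (pair_pmf w q)"
    (is "iid_steps M ?H n ?V _")
  unfolding iid_steps_def
proof (intro conjI ballI allI)
  let ?G = "gen_sigma M {1..} X"
  have sub: "F \<subseteq> Pow (space M)" "?G \<subseteq> Pow (space M)"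
    using F sigma_algebra_gen_sigma[of M "{1..}" X] by (simp_all add: sigma_algebra_iff2)
  interpret H: sigma_algebra "space M" ?H
    by (rule sigma_algebra_sigma_sets) (use sub in auto)
  have W_ev: "{\<omega> \<in> space M. \<forall>j\<in>{1..n}. W j \<omega> = z j} \<in> F" for z
    using W by (intro sigma_algebra_Collect_finite_Ball[OF F]) (auto simp: iid_steps_def)
  have X_ev: "{\<omega> \<in> space M. X (\<psi> z i) \<omega> = y} \<in> ?G" if "i \<in> {1..n}" for z i y
    using range that by (intro gen_sigma_event) simp
  fix i and x :: "'w \<times> 'v" assume i: "i \<in> {1..n}"
  \<comment> \<open>Taking the patterns of \<open>W\<close> extensional leaves only countably many
    of them. Each pattern fixes the index \<open>\<psi> z i\<close>, so the event becomes a
    countable union of events with deterministic indices.\<close>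
  let ?Z = "{z \<in> {1..n} \<rightarrow>\<^sub>E UNIV. z i = fst x}"
  have "{\<omega> \<in> space M. ?V i \<omega> = x} =
    (\<Union>z\<in>?Z. {\<omega> \<in> space M. \<forall>j\<in>{1..n}. W j \<omega> = z j} \<inter> {\<omega> \<in> space M. X (\<psi> z i) \<omega> = snd x})"
    (is "?L = ?R")
  proof (intro equalityI subsetI)
    fix \<omega> assume \<omega>: "\<omega> \<in> ?L"
    let ?z = "\<lambda>j\<in>{1..n}. W j \<omega>"
    have "\<psi> ?z i = \<psi> (\<lambda>j. W j \<omega>) i"
      by (rule cong) (use i in auto)
    then show "\<omega> \<in> ?R"
      using \<omega> i by (intro UN_I[of ?z]) auto
  next
    fix \<omega> assume "\<omega> \<in> ?R"
    then obtain z where z: "z i = fst x" "\<omega> \<in> space M" "\<forall>j\<in>{1..n}. W j \<omega> = z j"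
        "X (\<psi> z i) \<omega> = snd x"
      by auto
    have "\<psi> z i = \<psi> (\<lambda>j. W j \<omega>) i"
      by (rule cong) (use i z in auto)
    then show "\<omega> \<in> ?L"
      using z i by auto
  qed
  moreover have "countable ?Z"
    by (rule countable_subset[of _ "{1..n} \<rightarrow>\<^sub>E UNIV"]) (auto intro!: countable_PiE)
  moreover have "{\<omega> \<in> space M. \<forall>j\<in>{1..n}. W j \<omega> = z j} \<inter>
      {\<omega> \<in> space M. X (\<psi> z i) \<omega> = snd x} \<in> ?H" for z
    using W_ev[of z] X_ev[OF i, of z "snd x"] by (intro H.Int sigma_sets.Basic) simp_all
  ultimately show "{\<omega> \<in> space M. ?V i \<omega> = x} \<in> ?H"
    by (simp only:) (intro H.countable_UN' image_subsetI)
next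
  fix x :: "nat \<Rightarrow> 'w \<times> 'v"
  let ?z = "\<lambda>i. fst (x i)"
  let ?E = "{\<omega> \<in> space M. \<forall>j\<in>{1..n}. W j \<omega> = ?z j}"
  let ?D = "{\<omega> \<in> space M. \<forall>i\<in>{1..n}. X (\<psi> ?z i) \<omega> = snd (x i)}"
  \<comment> \<open>Where \<open>W\<close> follows the pattern \<open>?z\<close>,
    \<open>cong\<close> replaces the random indices by those of \<open>\<psi> ?z\<close>; what
    remains is an event of \<open>F\<close> and an event of \<open>X\<close> with fixed
    indices.\<close>
  have "(\<forall>i\<in>{1..n}. ?V i \<omega> = x i) \<longleftrightarrow>
      (\<forall>j\<in>{1..n}. W j \<omega> = ?z j) \<and> (\<forall>i\<in>{1..n}. X (\<psi> ?z i) \<omega> = snd (x i))" for \<omega>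
  proof (cases "\<forall>j\<in>{1..n}. W j \<omega> = ?z j")
    case True
    then have "\<psi> (\<lambda>j. W j \<omega>) i = \<psi> ?z i" if "i \<in> {1..n}" for i
      using that by (intro cong) auto
    then show ?thesis
      using True by (simp add: prod_eq_iff)
  qed (auto simp: prod_eq_iff)
  then have "{\<omega> \<in> space M. \<forall>i\<in>{1..n}. ?V i \<omega> = x i} = ?E \<inter> ?D"
    by blast
  also have "prob (?E \<inter> ?D) = prob ?E * prob ?D"
  proof (rule mutually_indep_prob_Int[OF ind])
    show "?E \<in> F"
      using W by (intro sigma_algebra_Collect_finite_Ball[OF F]) (auto simp: iid_steps_def)
    show "?D \<in> gen_sigma M {1..} X"
      using range
      by (intro sigma_algebra_Collect_finite_Ball sigma_algebra_gen_sigma gen_sigma_event) simp_all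
  qed
  also have "\<dots> = (\<Prod>i=1..n. pmf w (fst (x i))) * (\<Prod>i=1..n. pmf q (snd (x i)))"
    using W iid_reindex_prob[OF X inj range] by (simp add: iid_steps_def)
  also have "\<dots> = (\<Prod>i=1..n. pmf (pair_pmf w q) (x i))"
    by (simp add: pmf_pair_prod prod.distrib)
  finally show "prob {\<omega> \<in> space M. \<forall>i\<in>{1..n}. ?V i \<omega> = x i} =
    (\<Prod>i=1..n. pmf (pair_pmf w q) (x i))" .
qed

lemma (in prob_space) iid_steps_measurable:
  fixes W :: "nat \<Rightarrow> 'a \<Rightarrow> 'w::countable"
  assumes "iid_steps M F n W w" "F \<subseteq> events" "i \<in> {1..n}"
  shows "W i \<in> measurable M (count_space UNIV)"
proof (subst measurable_count_space_eq2_countable, intro conjI ballI)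
  fix x
  have "W i -` {x} \<inter> space M = {\<omega> \<in> space M. W i \<omega> = x}"
    by auto
  then show "W i -` {x} \<inter> space M \<in> events"
    using assms by (auto simp: iid_steps_def)
qed auto

text \<open>The space of value sequences is countable with all subsets measurable, so both measures
  are determined by their point masses.\<close>

lemma (in prob_space) distr_iid_steps:
  fixes W :: "nat \<Rightarrow> 'a \<Rightarrow> 'w::countable"
  assumes W: "iid_steps M F n W w" and F: "F \<subseteq> events"
  shows "distr M (\<Pi>\<^sub>M i\<in>{1..n}. count_space UNIV) (\<lambda>\<omega>. \<lambda>i\<in>{1..n}. W i \<omega>) =
    (\<Pi>\<^sub>M i\<in>{1..n}. measure_pmf w)" (is "?D = ?P")
proof -
  have meas: "(\<lambda>\<omega>. \<lambda>i\<in>{1..n}. W i \<omega>) \<in> measurable M (\<Pi>\<^sub>M i\<in>{1..n}. count_space UNIV)"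
    by (intro measurable_restrict iid_steps_measurable[OF W F])
  interpret P: product_prob_space "\<lambda>_. measure_pmf w" "{1..n}"
    by unfold_locales
  have PC: "sets (\<Pi>\<^sub>M i\<in>{1..n}. count_space (UNIV :: 'w set)) = Pow ({1..n} \<rightarrow>\<^sub>E UNIV)"
    using count_space_PiM_finite[of "{1..n}" "\<lambda>_. UNIV :: 'w set"] by simp
  have PP: "sets ?P = sets (\<Pi>\<^sub>M i\<in>{1..n}. count_space (UNIV :: 'w set))"
    by (intro sets_PiM_cong) auto
  show ?thesis
  proof (rule measure_eqI_countable)
    show "sets ?D = Pow ({1..n} \<rightarrow>\<^sub>E UNIV)" "sets ?P = Pow ({1..n} \<rightarrow>\<^sub>E UNIV)"
      using PC PP by simp_all
    show "countable ({1..n} \<rightarrow>\<^sub>E (UNIV :: 'w set))"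
      by (intro countable_PiE) auto
    fix x :: "nat \<Rightarrow> 'w" assume x: "x \<in> {1..n} \<rightarrow>\<^sub>E UNIV"
    have "(\<lambda>\<omega>. \<lambda>i\<in>{1..n}. W i \<omega>) -` {x} \<inter> space M = {\<omega> \<in> space M. \<forall>i\<in>{1..n}. W i \<omega> = x i}"
      using x by (auto simp: fun_eq_iff PiE_iff extensional_def)
    then have "emeasure ?D {x} = ennreal (\<Prod>i=1..n. pmf w (x i))"
      using W x PC by (subst emeasure_distr[OF meas]) (auto simp: iid_steps_def emeasure_eq_measure)
    moreover have "emeasure ?P (\<Pi>\<^sub>E i\<in>{1..n}. {x i}) = (\<Prod>i=1..n. emeasure (measure_pmf w) {x i})"
      by (intro P.emeasure_PiM) auto
    moreover have "(\<Pi>\<^sub>E i\<in>{1..n}. {x i}) = {x}"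
      using x by (intro PiE_singleton) (auto simp: PiE_def)
    ultimately show "emeasure ?D {x} = emeasure ?P {x}"
      by (simp add: emeasure_pmf_single prod_ennreal)
  qed
qed

text \<open>The joint law is a product measure, so the factorisation extends from points to
  rectangles; almost sure statements and images of the steps rest on this.\<close>

lemma (in prob_space) iid_steps_prob:
  fixes W :: "nat \<Rightarrow> 'a \<Rightarrow> 'w::countable"
  assumes W: "iid_steps M F n W w" and F: "F \<subseteq> events"
  shows "prob {\<omega> \<in> space M. \<forall>i\<in>{1..n}. W i \<omega> \<in> A i} = (\<Prod>i=1..n. measure_pmf.prob w (A i))"
proof -
  interpret P: finite_product_prob_space "\<lambda>_. measure_pmf w" "{1..n}"
    by unfold_locales auto
  have meas: "(\<lambda>\<omega>. \<lambda>i\<in>{1..n}. W i \<omega>) \<in> measurable M (\<Pi>\<^sub>M i\<in>{1..n}. count_space UNIV)"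
    by (intro measurable_restrict iid_steps_measurable[OF W F])
  have "(\<lambda>\<omega>. \<lambda>i\<in>{1..n}. W i \<omega>) -` (\<Pi>\<^sub>E i\<in>{1..n}. A i) \<inter> space M =
    {\<omega> \<in> space M. \<forall>i\<in>{1..n}. W i \<omega> \<in> A i}"
    by (auto simp: PiE_iff)
  then have "prob {\<omega> \<in> space M. \<forall>i\<in>{1..n}. W i \<omega> \<in> A i} =
      measure (distr M (\<Pi>\<^sub>M i\<in>{1..n}. count_space UNIV) (\<lambda>\<omega>. \<lambda>i\<in>{1..n}. W i \<omega>))
        (\<Pi>\<^sub>E i\<in>{1..n}. A i)"
    by (subst measure_distr[OF meas]) (auto intro!: sets_PiM_I_finite)
  also have "\<dots> = measure (\<Pi>\<^sub>M i\<in>{1..n}. measure_pmf w) (\<Pi>\<^sub>E i\<in>{1..n}. A i)"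
    unfolding distr_iid_steps[OF W F] ..
  also have "\<dots> = (\<Prod>i=1..n. measure_pmf.prob w (A i))"
    by (rule P.finite_measure_PiM_emb) auto
  finally show ?thesis .
qed

lemma (in prob_space) iid_steps_AE:
  fixes W :: "nat \<Rightarrow> 'a \<Rightarrow> 'w::countable"
  assumes W: "iid_steps M F n W w" and F: "F \<subseteq> events"
  shows "AE \<omega> in M. \<forall>i\<in>{1..n}. W i \<omega> \<in> set_pmf w"
proof (rule AE_I_eq_1)
  have [measurable]: "W i \<in> measurable M (count_space UNIV)" if "i \<in> {1..n}" for i
    using that by (rule iid_steps_measurable[OF W F])
  show "{\<omega> \<in> space M. \<forall>i\<in>{1..n}. W i \<omega> \<in> set_pmf w} \<in> events"
    by measurable
  show "emeasure M {\<omega> \<in> space M. \<forall>i\<in>{1..n}. W i \<omega> \<in> set_pmf w} = 1"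
    unfolding emeasure_eq_measure iid_steps_prob[OF assms]
    by (simp add: measure_pmf.prob_eq_1[THEN iffD2] AE_measure_pmf)
qed

lemma (in prob_space) iid_steps_map:
  fixes W :: "nat \<Rightarrow> 'a \<Rightarrow> 'w::countable"
  assumes W: "iid_steps M F n W w" and F: "F \<subseteq> events"
  shows "iid_steps M events n (\<lambda>i \<omega>. h (W i \<omega>)) (map_pmf h w)"
  unfolding iid_steps_def
proof (intro conjI ballI allI)
  fix i x assume "i \<in> {1..n}"
  note [measurable] = iid_steps_measurable[OF W F this]
  show "{\<omega> \<in> space M. h (W i \<omega>) = x} \<in> events"
    by measurable
next
  fix x
  show "prob {\<omega> \<in> space M. \<forall>i\<in>{1..n}. h (W i \<omega>) = x i} = (\<Prod>i=1..n. pmf (map_pmf h w) (x i))"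
    using iid_steps_prob[OF W F, of "\<lambda>i. h -` {x i}"] by (simp add: pmf_map)
qed

text \<open>Independence at the consecutive times 0, 1, ..., \<open>n\<close> and stationarity
  reduce each unit increment to \<open>X 1 - X 0\<close>, which is \<open>X 1\<close> almost surely.
  The increments stay within the sigma-algebra of the process and so inherit its independence from
  the claims.\<close>

lemma (in prob_space) iid_steps_increments:
  fixes X :: "nat \<Rightarrow> 'a \<Rightarrow> 'v::{countable, ab_group_add}"
  assumes meas: "\<And>t. X t \<in> measurable M (count_space UNIV)"
    and zero: "AE \<omega> in M. X 0 \<omega> = 0"
    and ind: "independent_increments M X" and stat: "stationary_increments M X"
    and law: "distr M (count_space UNIV) (X 1) = measure_pmf q"
  shows "iid_steps M (gen_sigma M UNIV X) n (\<lambda>i \<omega>. X i \<omega> - X (i - 1) \<omega>) q"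
  unfolding iid_steps_def
proof (intro conjI ballI allI)
  interpret G: sigma_algebra "space M" "gen_sigma M UNIV X"
    by (rule sigma_algebra_gen_sigma)
  fix i x
  \<comment> \<open>Splitting over the countably many values of the earlier state expresses the
    increment event through events of the process.\<close>
  have "{\<omega> \<in> space M. X i \<omega> - X (i - 1) \<omega> = x} =
    (\<Union>y. {\<omega> \<in> space M. X i \<omega> = x + y} \<inter> {\<omega> \<in> space M. X (i - 1) \<omega> = y})"
    by (auto simp: algebra_simps)
  then show "{\<omega> \<in> space M. X i \<omega> - X (i - 1) \<omega> = x} \<in> gen_sigma M UNIV X"
    by (auto intro!: G.countable_UN' G.Int gen_sigma_event)
next
  fix x
  let ?D = "\<lambda>k \<omega>. X (Suc k) \<omega> - X k \<omega>"
  have iv: "indep_vars (\<lambda>_. count_space UNIV) ?D {..<n}"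
    using ind[unfolded independent_increments_def, rule_format, of "\<lambda>k. k" n]
    by (simp add: strict_mono_def)
  have D: "prob {\<omega> \<in> space M. ?D k \<omega> = y} = pmf q y" if "k < n" for k y
  proof (rule pmf_eq_prob[symmetric])
    have iv1: "indep_vars (\<lambda>_. count_space UNIV) ?D {..<Suc k}" for k
      using ind[unfolded independent_increments_def, rule_format, of "\<lambda>k. k" "Suc k"]
      by (simp add: strict_mono_def)
    then show "?D k \<in> measurable M (count_space UNIV)" for k
      unfolding indep_vars_def by blast
    then have *: "(\<lambda>\<omega>. X 1 \<omega> - X 0 \<omega>) \<in> measurable M (count_space UNIV)"
      by (metis One_nat_def)
    have "distr M (count_space UNIV) (?D k) =
        distr M (count_space UNIV) (\<lambda>\<omega>. X 1 \<omega> - X 0 \<omega>)"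
      using stat[unfolded stationary_increments_def, rule_format, of k 1] by simp
    also have "\<dots> = distr M (count_space UNIV) (X 1)"
      by (rule distr_cong_AE) (use zero meas * in auto)
    finally show "distr M (count_space UNIV) (?D k) = measure_pmf q"
      using law by simp
  qed
  show "prob {\<omega> \<in> space M. \<forall>i\<in>{1..n}. X i \<omega> - X (i - 1) \<omega> = x i} = (\<Prod>i=1..n. pmf q (x i))"
  proof (cases "n = 0")
    case True
    then show ?thesis
      by (simp add: prob_space)
  next
    case False
    have "{\<omega> \<in> space M. \<forall>i\<in>{1..n}. X i \<omega> - X (i - 1) \<omega> = x i} =
        {\<omega> \<in> space M. \<forall>k\<in>{..<n}. ?D k \<omega> = x (Suc k)}"
      unfolding image_Suc_lessThan[symmetric] by simp
    also have "\<dots> = (\<Inter>k\<in>{..<n}. ?D k -` {x (Suc k)} \<inter> space M)"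
      using False by auto
    also have "prob \<dots> = (\<Prod>k<n. prob (?D k -` {x (Suc k)} \<inter> space M))"
      by (rule indep_varsD[OF iv]) (use False in auto)
    also have "\<dots> = (\<Prod>k<n. pmf q (x (Suc k)))"
      using D by (intro prod.cong) (auto simp: vimage_def Int_def conj_commute)
    also have "\<dots> = (\<Prod>i=1..n. pmf q (x i))"
      by (simp add: prod.atLeast1_atMost_eq)
    finally show ?thesis .
  qed
qed

section \<open>Numbering the successes of a counting path\<close>

text \<open>
  Successes are numbered consecutively, which is how a counting process consumes its summands;
  the values \<open>n + i\<close> at failures only serve to make the numbering injective on \<open>{1..n}\<close>.
\<close>

definition success_index :: "nat \<Rightarrow> (nat \<Rightarrow> bool) \<Rightarrow> nat \<Rightarrow> nat" where
  "success_index n c i = (if c i then card {j \<in> {1..i}. c j} else n + i)"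

lemma success_index_True: "success_index n (\<lambda>_. True) i = i"
  by (simp add: success_index_def del: atLeastAtMost_iff)

lemma success_index_ge_1:
  assumes "i \<in> {1..n}"
  shows "success_index n c i \<ge> 1"
proof (cases "c i")
  case True
  then have "{i} \<subseteq> {j \<in> {1..i}. c j}"
    using assms by auto
  from card_mono[OF _ this] show ?thesis
    using True by (simp add: success_index_def)
qed (use assms in \<open>auto simp: success_index_def\<close>)

text \<open>Only values of \<open>c\<close> up to \<open>i\<close> enter, so a finite pattern of
  steps determines the index, as the relabelling of an independent family requires.\<close>

lemma success_index_cong:
  assumes "\<And>j. j \<in> {1..n} \<Longrightarrow> c j = c' j" and "i \<in> {1..n}"
  shows "success_index n c i = success_index n c' i"
proof -
  have "{j \<in> {1..i}. c j} = {j \<in> {1..i}. c' j}"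
    using assms by auto
  then show ?thesis
    using assms by (simp add: success_index_def)
qed

text \<open>Two successes differ because the count increases strictly, two failures because
  \<open>n + i\<close> does. A success and a failure differ because a count is at most
  \<open>n\<close>, while the value at a failure exceeds \<open>n\<close>.\<close>

lemma inj_on_success_index: "inj_on (success_index n c) {1..n}"
proof (rule linorder_inj_onI)
  fix i k assume ik: "i < k" "i \<in> {1..n}" "k \<in> {1..n}"
  have card: "card {j \<in> {1..l}. c j} \<le> l" for l
  proof -
    have "card {j \<in> {1..l}. c j} \<le> card {1..l}"
      by (intro card_mono) auto
    then show ?thesis
      by simp
  qed
  have "card {j \<in> {1..i}. c j} < card {j \<in> {1..k}. c j}" if "c k"
  proof (rule psubset_card_mono)
    have "k \<in> {j \<in> {1..k}. c j}" "k \<notin> {j \<in> {1..i}. c j}"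
        "{j \<in> {1..i}. c j} \<subseteq> {j \<in> {1..k}. c j}"
      using that ik by auto
    then show "{j \<in> {1..i}. c j} \<subset> {j \<in> {1..k}. c j}"
      by blast
  qed simp
  then show "success_index n c i \<noteq> success_index n c k"
    using ik card[of i] card[of k] by (auto simp: success_index_def)
qed auto

lemma sum_success_index:
  fixes y :: "nat \<Rightarrow> 'v::comm_monoid_add"
  assumes "b 0 = 0" and b: "\<And>i. i \<in> {1..n} \<Longrightarrow> b i = b (i - 1) + (if c i then 1 else 0)"
    and "t \<le> n"
  shows "(\<Sum>j=1..b t. y j) = (\<Sum>i=1..t. if c i then y (success_index n c i) else 0)"
proof -
  \<comment> \<open>The induction carries the number of successes along: at a success the new
    summand has index \<open>b (Suc t)\<close>, and this must be recognised as the count returned by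
    \<open>success_index\<close>.\<close>
  have "b t = card {j \<in> {1..t}. c j} \<and> ?thesis"
    using \<open>t \<le> n\<close>
  proof (induction t)
    case 0
    then show ?case
      using \<open>b 0 = 0\<close> by simp
  next
    case (Suc t)
    then have IH: "(\<Sum>j=1..b t. y j) = (\<Sum>i=1..t. if c i then y (success_index n c i) else 0)"
      by (meson Suc_leD)
    have S: "{j \<in> {1..Suc t}. c j} = (if c (Suc t) then insert (Suc t) else id) {j \<in> {1..t}. c j}"
      by (auto simp: le_Suc_eq)
    have "card {j \<in> {1..Suc t}. c j} = card {j \<in> {1..t}. c j} + (if c (Suc t) then 1 else 0)"
      unfolding S by simp
    then have bS: "b (Suc t) = card {j \<in> {1..Suc t}. c j}"
      using Suc b[of "Suc t"] by simp
    show ?case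
    proof (cases "c (Suc t)")
      case True
      then have sum: "(\<Sum>j=1..b (Suc t). y j) = (\<Sum>j=1..b t. y j) + y (success_index n c (Suc t))"
        using Suc.prems b[of "Suc t"] bS by (simp add: success_index_def)
      show ?thesis
        unfolding sum IH using True bS by simp
    next
      case False
      then have sum: "(\<Sum>j=1..b (Suc t). y j) = (\<Sum>j=1..b t. y j)"
        using Suc.prems b[of "Suc t"] by simp
      show ?thesis
        unfolding sum IH using False bS by simp
    qed
  qed
  then show ?thesis ..
qed

section \<open>Measurability of discrete sums\<close>

text \<open>\<open>h\<close> may be any function: on each of the countably many events where
  \<open>g\<close> is constant, a function of \<open>f\<close> alone remains.\<close>

lemma measurable_count_space_binop:
  fixes f :: "'a \<Rightarrow> 'b::countable" and g :: "'a \<Rightarrow> 'c::countable"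
  assumes "f \<in> measurable M (count_space UNIV)" "g \<in> measurable M (count_space UNIV)"
  shows "(\<lambda>\<omega>. h (f \<omega>) (g \<omega>)) \<in> measurable M (count_space UNIV)"
proof (rule measurable_compose_countable[OF _ assms(2)])
  show "(\<lambda>\<omega>. h (f \<omega>) y) \<in> measurable M (count_space UNIV)" for y
    by (rule measurable_compose[OF assms(1)]) simp
qed

lemma measurable_count_space_sum:
  fixes X :: "'i \<Rightarrow> 'a \<Rightarrow> 'v::{countable, comm_monoid_add}"
  assumes "\<And>i. i \<in> A \<Longrightarrow> X i \<in> measurable M (count_space UNIV)"
  shows "(\<lambda>\<omega>. \<Sum>i\<in>A. X i \<omega>) \<in> measurable M (count_space UNIV)"
  using assms by (induction A rule: infinite_finite_induct)
    (auto intro: measurable_count_space_binop[where h = "(+)"])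

lemma measurable_count_space_random_sum:
  fixes X :: "nat \<Rightarrow> 'a \<Rightarrow> 'v::{countable, comm_monoid_add}"
  assumes "N \<in> measurable M (count_space UNIV)"
    and "\<And>i. i \<ge> k \<Longrightarrow> X i \<in> measurable M (count_space UNIV)"
  shows "(\<lambda>\<omega>. \<Sum>i=k..N \<omega>. X i \<omega>) \<in> measurable M (count_space UNIV)"
  by (rule measurable_compose_countable[OF _ assms(1)]) (intro measurable_count_space_sum assms(2), simp)

section \<open>Random walks and their finite dimensional distributions\<close>

text \<open>\<open>Z\<close> may change with \<open>n\<close> because the indices given to failures
  do. The equality is almost sure because the counting processes start at 0 and have increments 0 or
  1 only almost surely.\<close>

definition walk :: "'a measure \<Rightarrow> 'v pmf \<Rightarrow> (nat \<Rightarrow> 'a \<Rightarrow> 'v::comm_monoid_add) \<Rightarrow> bool" where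
  "walk M \<nu> S \<longleftrightarrow>
     (\<forall>t. S t \<in> measurable M (count_space UNIV)) \<and>
     (\<forall>n. \<exists>Z. iid_steps M (sets M) n Z \<nu> \<and>
        (AE \<omega> in M. \<forall>t\<le>n. S t \<omega> = (\<Sum>i=1..t. Z i \<omega>)))"

lemma (in prob_space) walkI:
  fixes S :: "nat \<Rightarrow> 'a \<Rightarrow> 'v::{countable, comm_monoid_add}"
    and W :: "nat \<Rightarrow> nat \<Rightarrow> 'a \<Rightarrow> 'w::countable"
  assumes "\<And>t. S t \<in> measurable M (count_space UNIV)"
    and W: "\<And>n. iid_steps M F n (W n) w" "F \<subseteq> events"
    and "\<And>n. AE \<omega> in M. \<forall>t\<le>n. S t \<omega> = (\<Sum>i=1..t. h (W n i \<omega>))"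
  shows "walk M (map_pmf h w) S"
  unfolding walk_def using assms(1,4) iid_steps_map[OF W] by blast

text \<open>A finite product of countable discrete spaces is discrete, so every functional
  \<open>g\<close> is measurable. It is applied to restricted sequences because the product measure
  lives on extensional functions.\<close>

lemma (in prob_space) distr_fun_iid_steps:
  fixes Z :: "nat \<Rightarrow> 'a \<Rightarrow> 'v::countable"
  assumes Z: "iid_steps M events n Z \<nu>" and g: "\<And>z. g z \<in> space N"
  shows "(\<lambda>\<omega>. g (\<lambda>i\<in>{1..n}. Z i \<omega>)) \<in> measurable M N"
    and "distr M N (\<lambda>\<omega>. g (\<lambda>i\<in>{1..n}. Z i \<omega>)) = distr (\<Pi>\<^sub>M i\<in>{1..n}. measure_pmf \<nu>) N g"
proof -
  let ?C = "\<Pi>\<^sub>M i\<in>{1..n}. count_space (UNIV :: 'v set)"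
  have C: "?C = count_space ({1..n} \<rightarrow>\<^sub>E UNIV)"
    using count_space_PiM_finite[of "{1..n}" "\<lambda>_. UNIV :: 'v set"] by simp
  have G: "g \<in> measurable ?C N"
    unfolding C using g by auto
  have Z_meas: "(\<lambda>\<omega>. \<lambda>i\<in>{1..n}. Z i \<omega>) \<in> measurable M ?C"
    by (intro measurable_restrict iid_steps_measurable[OF Z]) auto
  show "(\<lambda>\<omega>. g (\<lambda>i\<in>{1..n}. Z i \<omega>)) \<in> measurable M N"
    by (rule measurable_compose[OF Z_meas G])
  have "distr M N (\<lambda>\<omega>. g (\<lambda>i\<in>{1..n}. Z i \<omega>)) = distr (distr M ?C (\<lambda>\<omega>. \<lambda>i\<in>{1..n}. Z i \<omega>)) N g"
    using distr_distr[OF G Z_meas] by (simp add: comp_def)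
  also have "distr M ?C (\<lambda>\<omega>. \<lambda>i\<in>{1..n}. Z i \<omega>) = (\<Pi>\<^sub>M i\<in>{1..n}. measure_pmf \<nu>)"
    by (rule distr_iid_steps[OF Z]) simp
  finally show "distr M N (\<lambda>\<omega>. g (\<lambda>i\<in>{1..n}. Z i \<omega>)) =
      distr (\<Pi>\<^sub>M i\<in>{1..n}. measure_pmf \<nu>) N g" .
qed

text \<open>The right-hand side depends on the walk only through \<open>\<nu>\<close>; walks with
  the same step law, even on different spaces, therefore share their finite dimensional
  distributions.\<close>

lemma (in prob_space) distr_walk:
  fixes S :: "nat \<Rightarrow> 'a \<Rightarrow> 'v::{countable, comm_monoid_add}"
  assumes "walk M \<nu> S" and J: "J \<subseteq> {..n}"
  shows "distr M (\<Pi>\<^sub>M t\<in>J. count_space UNIV) (\<lambda>\<omega>. \<lambda>t\<in>J. S t \<omega>) =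
    distr (\<Pi>\<^sub>M i\<in>{1..n}. measure_pmf \<nu>) (\<Pi>\<^sub>M t\<in>J. count_space UNIV)
      (\<lambda>z. \<lambda>t\<in>J. \<Sum>i=1..t. z i)" (is "?L = _")
proof -
  obtain Z where Z: "iid_steps M events n Z \<nu>"
    and S: "AE \<omega> in M. \<forall>t\<le>n. S t \<omega> = (\<Sum>i=1..t. Z i \<omega>)"
    using assms(1) unfolding walk_def by blast
  have S_meas: "S t \<in> measurable M (count_space UNIV)" for t
    using assms(1) by (simp add: walk_def)
  let ?N = "\<Pi>\<^sub>M t\<in>J. count_space UNIV" and ?G = "\<lambda>z. \<lambda>t\<in>J. \<Sum>i=1..t. z i"
  have g: "?G z \<in> space ?N" for z
    by (simp add: space_PiM)
  have GZ: "?G (\<lambda>i\<in>{1..n}. Z i \<omega>) = (\<lambda>t\<in>J. \<Sum>i=1..t. Z i \<omega>)" for \<omega>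
    using J by (auto simp: fun_eq_iff intro!: sum.cong)
  have "?L = distr M ?N (\<lambda>\<omega>. ?G (\<lambda>i\<in>{1..n}. Z i \<omega>))"
  proof (rule distr_cong_AE)
    show "AE \<omega> in M. (\<lambda>t\<in>J. S t \<omega>) = ?G (\<lambda>i\<in>{1..n}. Z i \<omega>)"
      using S unfolding GZ by eventually_elim (use J in \<open>auto simp: fun_eq_iff\<close>)
    show "(\<lambda>\<omega>. \<lambda>t\<in>J. S t \<omega>) \<in> measurable M ?N"
      by (intro measurable_restrict S_meas)
    show "(\<lambda>\<omega>. ?G (\<lambda>i\<in>{1..n}. Z i \<omega>)) \<in> measurable M ?N"
      by (rule distr_fun_iid_steps[OF Z g])
  qed simp_all
  also have "\<dots> = distr (\<Pi>\<^sub>M i\<in>{1..n}. measure_pmf \<nu>) ?N ?G"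
    by (rule distr_fun_iid_steps[OF Z g])
  finally show ?thesis .
qed

lemma walk_same_fdd:
  fixes S :: "nat \<Rightarrow> 'a \<Rightarrow> 'v::{countable, comm_monoid_add}" and S' :: "nat \<Rightarrow> 'b \<Rightarrow> 'v"
  assumes "prob_space M" "walk M \<nu> S" "prob_space M'" "walk M' \<nu> S'"
  shows "same_fdd M S M' S'"
  unfolding same_fdd_def
proof (intro conjI allI impI)
  fix J :: "nat set" assume "finite J"
  then obtain n where "J \<subseteq> {..n}"
    using finite_nat_iff_bounded_le by blast
  then show "distr M (\<Pi>\<^sub>M t\<in>J. count_space UNIV) (\<lambda>\<omega>. \<lambda>t\<in>J. S t \<omega>) =
    distr M' (\<Pi>\<^sub>M t\<in>J. count_space UNIV) (\<lambda>\<omega>. \<lambda>t\<in>J. S' t \<omega>)"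
    by (simp add: prob_space.distr_walk[OF assms(1,2)] prob_space.distr_walk[OF assms(3,4)])
qed (use assms in \<open>auto simp: walk_def\<close>)

section \<open>Attaching independent families to the steps\<close>

text \<open>Hiding \<open>F\<close> behind an existential lets the sigma-algebra grow with every
  absorbed family without being named; \<open>Fs\<close> lists the families still to be
  absorbed.\<close>

definition indep_steps ::
    "'a measure \<Rightarrow> 'a set set list \<Rightarrow> nat \<Rightarrow> (nat \<Rightarrow> 'a \<Rightarrow> 'w) \<Rightarrow> 'w pmf \<Rightarrow> bool" where
  "indep_steps M Fs n W w \<longleftrightarrow>
     (\<exists>F. sigma_algebra (space M) F \<and> mutually_indep M (F # Fs) \<and> iid_steps M F n W w)"

lemma (in prob_space) mutually_indep_events:
  "mutually_indep M Fs \<Longrightarrow> F \<in> set Fs \<Longrightarrow> F \<subseteq> events"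
  by (auto simp: mutually_indep_def indep_sets_def in_set_conv_nth)

text \<open>Absorbs one family: it leaves the list, and step \<open>i\<close> receives its member at
  the index given by the clock \<open>c\<close>. The clock may inspect all components collected so
  far, so the lemma can be applied repeatedly.\<close>

lemma (in prob_space) indep_steps_extend:
  fixes W :: "nat \<Rightarrow> 'a \<Rightarrow> 'w::countable" and X :: "nat \<Rightarrow> 'a \<Rightarrow> 'v"
  assumes W: "indep_steps M (gen_sigma M {1..} X # Fs) n W w"
    and Fs: "\<forall>H\<in>set Fs. sigma_algebra (space M) H"
    and X: "iid M X" "distr M (count_space UNIV) (X 1) = measure_pmf q"
  shows "indep_steps M Fs n (\<lambda>i \<omega>. (W i \<omega>, X (success_index n (\<lambda>j. c (W j \<omega>)) i) \<omega>)) (pair_pmf w q)"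
proof -
  obtain F where F: "sigma_algebra (space M) F" "mutually_indep M (F # gen_sigma M {1..} X # Fs)"
      "iid_steps M F n W w"
    using W unfolding indep_steps_def by blast
  let ?H = "sigma_sets (space M) (F \<union> gen_sigma M {1..} X)"
  have "sigma_algebra (space M) ?H"
    using F(1) sigma_algebra_gen_sigma[of M "{1..}" X]
    by (intro sigma_algebra_sigma_sets) (simp add: sigma_algebra_iff2)
  moreover have "mutually_indep M (?H # Fs)"
    using F Fs sigma_algebra_gen_sigma by (intro mutually_indep_merge) auto
  moreover have "iid_steps M ?H n (\<lambda>i \<omega>. (W i \<omega>, X (success_index n (\<lambda>j. c (W j \<omega>)) i) \<omega>))
      (pair_pmf w q)"
    by (rule iid_steps_pair[OF F(2,1,3) X inj_on_success_index success_index_ge_1])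
      (assumption, rule success_index_cong, simp_all)
  ultimately show ?thesis
    unfolding indep_steps_def by blast
qed

lemma (in prob_space) indep_steps_iid_steps:
  assumes "indep_steps M Fs n W w"
  shows "iid_steps M events n W w"
  using assms mutually_indep_events unfolding indep_steps_def
  by (metis iid_steps_mono list.set_intros(1))

lemma sum_counting_path:
  fixes N :: "nat \<Rightarrow> nat" and y :: "nat \<Rightarrow> 'v::comm_monoid_add"
  assumes "N 0 = 0" and D: "\<And>i. i \<in> {1..n} \<Longrightarrow> int (N i) - int (N (i - 1)) \<in> {0, 1}"
    and "t \<le> n"
  shows "(\<Sum>j=1..N t. y j) =
    (\<Sum>i=1..t. if int (N i) - int (N (i - 1)) = 1
      then y (success_index n (\<lambda>j. int (N j) - int (N (j - 1)) = 1) i) else 0)"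
proof (rule sum_success_index)
  fix i assume "i \<in> {1..n}"
  from D[OF this]
  show "N i = N (i - 1) + (if int (N i) - int (N (i - 1)) = 1 then 1 else 0)"
    by auto
qed fact+

lemma sum_atLeast0_drop:
  fixes y :: "nat \<Rightarrow> 'v::comm_monoid_add"
  assumes "y 0 = 0"
  shows "(\<Sum>i=0..m. y i) = (\<Sum>i=1..m. y i)"
  using assms by (simp add: sum.atLeast_Suc_atMost)

text \<open>An increment that is 0 or 1 can serve as a factor in place of the case distinction; in
  this form it enters \<open>claim\<close>.\<close>

lemma sum_counting_path_int:
  fixes N :: "nat \<Rightarrow> nat" and y :: "nat \<Rightarrow> int"
  assumes "N 0 = 0" and D: "\<And>i. i \<in> {1..n} \<Longrightarrow> int (N i) - int (N (i - 1)) \<in> {0, 1}"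
    and "t \<le> n" and "y 0 = 0"
  shows "(\<Sum>j=0..N t. y j) =
    (\<Sum>i=1..t. (int (N i) - int (N (i - 1))) *
      y (success_index n (\<lambda>j. int (N j) - int (N (j - 1)) = 1) i))"
proof -
  have "(\<Sum>j=0..N t. y j) = (\<Sum>j=1..N t. y j)"
    using \<open>y 0 = 0\<close> by (rule sum_atLeast0_drop)
  also have "\<dots> = (\<Sum>i=1..t. if int (N i) - int (N (i - 1)) = 1
      then y (success_index n (\<lambda>j. int (N j) - int (N (j - 1)) = 1) i) else 0)"
    by (rule sum_counting_path[OF assms(1-3)])
  also have "\<dots> = (\<Sum>i=1..t. (int (N i) - int (N (i - 1))) *
      y (success_index n (\<lambda>j. int (N j) - int (N (j - 1)) = 1) i))"
  proof (rule sum.cong[OF refl])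
    fix i assume "i \<in> {1..t}"
    with \<open>t \<le> n\<close> have "i \<in> {1..n}"
      by simp
    from D[OF this] show "(if int (N i) - int (N (i - 1)) = 1
        then y (success_index n (\<lambda>j. int (N j) - int (N (j - 1)) = 1) i) else 0) =
      (int (N i) - int (N (i - 1))) *
        y (success_index n (\<lambda>j. int (N j) - int (N (j - 1)) = 1) i)"
      by (elim insertE) simp_all
  qed
  finally show ?thesis .
qed

section \<open>The multinomial process as the clock of a random walk\<close>

definition claim :: "int \<times> int \<times> int \<Rightarrow> int \<Rightarrow> int \<Rightarrow> int \<times> int \<Rightarrow> int \<times> int" where
  "claim d y1 y2 y34 =
     (case d of (d0, d1, d2) \<Rightarrow> (d1 * y1 + d0 * fst y34, d2 * y2 + d0 * snd y34))"

text \<open>The nesting of the pairs follows the order in which the families are absorbed: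
  \<open>Y 1\<close>, \<open>Y 2\<close>, and the pairs of \<open>Y 3\<close> and
  \<open>Y 4\<close>.\<close>

definition claim_law ::
    "(int \<times> int \<times> int) pmf \<Rightarrow> int pmf \<Rightarrow> int pmf \<Rightarrow> (int \<times> int) pmf \<Rightarrow> (int \<times> int) pmf" where
  "claim_law \<delta> q1 q2 q34 =
     map_pmf (\<lambda>(((d, y1), y2), y34). claim d y1 y2 y34)
       (pair_pmf (pair_pmf (pair_pmf \<delta> q1) q2) q34)"

lemma claim_sizes_measurable:
  assumes "claim_sizes M Y" and "k \<in> {1..4}"
  shows "Y k i \<in> measurable M (count_space UNIV)"
proof (cases "i \<ge> 1")
  case True
  then show ?thesis
    using assms by (auto simp: claim_sizes_def)
next
  case False
  then have zero: "Y k i \<omega> = 0" if "\<omega> \<in> space M" for \<omega>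
    using assms that by (auto simp: claim_sizes_def not_less_eq_eq)
  have "Y k i \<in> measurable M (count_space UNIV) \<longleftrightarrow>
      (\<lambda>_. 0 :: int) \<in> measurable M (count_space UNIV)"
    by (rule measurable_cong) (rule zero)
  then show ?thesis
    by simp
qed

lemma measurable_int_triple:
  fixes f g h :: "'a \<Rightarrow> nat"
  assumes "f \<in> measurable M (count_space UNIV)" "g \<in> measurable M (count_space UNIV)"
    and "h \<in> measurable M (count_space UNIV)"
  shows "(\<lambda>\<omega>. (int (f \<omega>), int (g \<omega>), int (h \<omega>))) \<in> measurable M (count_space UNIV)"
  using measurable_count_space_binop[OF assms(1)
      measurable_count_space_binop[OF assms(2,3), where h = Pair],
      where h = "\<lambda>a bc. (int a, int (fst bc), int (snd bc))"]
  by simp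

text \<open>In one time unit at most one counter increases, and then by one: at \<open>t = 1\<close>
  the multinomial formula leaves only four points.\<close>

lemma (in prob_space) multinomial_step_law:
  assumes B: "multinomial_process M p0 p1 p2 B0 B1 B2"
    and \<delta>: "distr M (count_space UNIV) (\<lambda>\<omega>. (int (B0 1 \<omega>), int (B1 1 \<omega>), int (B2 1 \<omega>))) =
      measure_pmf \<delta>"
  shows "pmf \<delta> (d0, d1, d2) =
    (if (d0, d1, d2) = (0, 0, 0) then 1 - (p0 + p1 + p2)
     else if (d0, d1, d2) = (1, 0, 0) then p0
     else if (d0, d1, d2) = (0, 1, 0) then p1
     else if (d0, d1, d2) = (0, 0, 1) then p2 else 0)"
proof -
  let ?X = "\<lambda>\<omega>. (int (B0 1 \<omega>), int (B1 1 \<omega>), int (B2 1 \<omega>))"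
  have Bm: "B0 1 \<in> measurable M (count_space UNIV)" "B1 1 \<in> measurable M (count_space UNIV)"
      "B2 1 \<in> measurable M (count_space UNIV)"
    using B by (auto simp: multinomial_process_def)
  have X: "?X \<in> measurable M (count_space UNIV)"
    by (intro measurable_int_triple Bm)
  have law: "prob {\<omega> \<in> space M. B0 1 \<omega> = b0 \<and> B1 1 \<omega> = b1 \<and> B2 1 \<omega> = b2} =
          (if b0 + b1 + b2 \<le> 1
           then fact 1 / (fact b0 * fact b1 * fact b2 * fact (1 - b0 - b1 - b2)) *
                p0 ^ b0 * p1 ^ b1 * p2 ^ b2 * (1 - (p0 + p1 + p2)) ^ (1 - b0 - b1 - b2)
           else 0)" for b0 b1 b2
    using B unfolding multinomial_process_def by blast
  have P: "pmf \<delta> (d0, d1, d2) = prob {\<omega> \<in> space M. ?X \<omega> = (d0, d1, d2)}"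
    by (rule pmf_eq_prob[OF X \<delta>])
  show ?thesis
  \<comment> \<open>The formula speaks of natural numbers; integer triples with a negative
    coordinate have mass zero because the counters are nonnegative.\<close>
  proof (cases "d0 \<ge> 0 \<and> d1 \<ge> 0 \<and> d2 \<ge> 0")
    case True
    then obtain b0 b1 b2 where d: "d0 = int b0" "d1 = int b1" "d2 = int b2"
      by (metis nonneg_int_cases)
    have P': "pmf \<delta> (int b0, int b1, int b2) =
        prob {\<omega> \<in> space M. B0 1 \<omega> = b0 \<and> B1 1 \<omega> = b1 \<and> B2 1 \<omega> = b2}"
      using P by (simp add: d)
    show ?thesis
    proof (cases "b0 + b1 + b2 \<le> 1")
      case True
      then have "(b0, b1, b2) \<in> {(0, 0, 0), (1, 0, 0), (0, 1, 0), (0, 0, 1)}"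
        by auto
      then show ?thesis
        using P' unfolding law d by auto
    next
      case False
      then show ?thesis
        using P' unfolding law d by auto
    qed
  next
    case False
    then have "{\<omega> \<in> space M. ?X \<omega> = (d0, d1, d2)} = {}"
      by auto
    then show ?thesis
      using False unfolding P by auto
  qed
qed

text \<open>Each counter is the clock of its own claims, so the families are relabelled separately.
  \<open>Y 3\<close> and \<open>Y 4\<close> share the clock \<open>B0\<close> and are absorbed as
  pairs, which preserves their dependence.\<close>

lemma (in prob_space) walk_multinomial:
  fixes S1 S2 :: "nat \<Rightarrow> 'a \<Rightarrow> int"
  assumes B: "multinomial_process M p0 p1 p2 B0 B1 B2"
    and Y: "claim_sizes M Y"
    and ind: "mutually_indep M
           [gen_sigma M UNIV (\<lambda>t \<omega>. (B0 t \<omega>, B1 t \<omega>, B2 t \<omega>)),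
            gen_sigma M {1..} (Y 1),
            gen_sigma M {1..} (Y 2),
            gen_sigma M {1..} (\<lambda>i \<omega>. (Y 3 i \<omega>, Y 4 i \<omega>))]"
    and S1: "\<And>t \<omega>. S1 t \<omega> = (\<Sum>i=0..B1 t \<omega>. Y 1 i \<omega>) + (\<Sum>i=0..B0 t \<omega>. Y 3 i \<omega>)"
    and S2: "\<And>t \<omega>. S2 t \<omega> = (\<Sum>i=0..B2 t \<omega>. Y 2 i \<omega>) + (\<Sum>i=0..B0 t \<omega>. Y 4 i \<omega>)"
    and \<delta>: "distr M (count_space UNIV) (\<lambda>\<omega>. (int (B0 1 \<omega>), int (B1 1 \<omega>), int (B2 1 \<omega>))) =
      measure_pmf \<delta>"
    and q1: "distr M (count_space UNIV) (Y 1 1) = measure_pmf q1"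
    and q2: "distr M (count_space UNIV) (Y 2 1) = measure_pmf q2"
    and q34: "distr M (count_space UNIV) (\<lambda>\<omega>. (Y 3 1 \<omega>, Y 4 1 \<omega>)) = measure_pmf q34"
  shows "walk M (claim_law \<delta> q1 q2 q34) (\<lambda>t \<omega>. (S1 t \<omega>, S2 t \<omega>))"
proof -
  let ?B = "\<lambda>t \<omega>. (B0 t \<omega>, B1 t \<omega>, B2 t \<omega>)"
  let ?X = "\<lambda>t \<omega>. (int (B0 t \<omega>), int (B1 t \<omega>), int (B2 t \<omega>))"
  define D where "D = (\<lambda>i \<omega>. ?X i \<omega> - ?X (i - 1) \<omega>)"
  have Bm: "B0 t \<in> measurable M (count_space UNIV)" "B1 t \<in> measurable M (count_space UNIV)"
      "B2 t \<in> measurable M (count_space UNIV)" for t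
    using B by (auto simp: multinomial_process_def)
  have Xm: "?X t \<in> measurable M (count_space UNIV)" for t
    by (intro measurable_int_triple Bm)
  have B_zero: "AE \<omega> in M. B0 0 \<omega> = 0 \<and> B1 0 \<omega> = 0 \<and> B2 0 \<omega> = 0"
    using B by (auto simp: multinomial_process_def)
  have iid_Y: "iid M (Y 1)" "iid M (Y 2)" "iid M (\<lambda>i \<omega>. (Y 3 i \<omega>, Y 4 i \<omega>))"
    using Y by (auto simp: claim_sizes_def)
  have Y0: "Y k 0 \<omega> = 0" if "k \<in> {1..4}" "\<omega> \<in> space M" for k \<omega>
    using Y that by (auto simp: claim_sizes_def)
  have "iid_steps M (gen_sigma M UNIV ?X) n D \<delta>" for n
    unfolding D_def
  proof (rule iid_steps_increments[where X = ?X, OF Xm _ _ _ \<delta>])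
    show "AE \<omega> in M. ?X 0 \<omega> = 0"
      using B_zero by eventually_elim (simp add: zero_prod_def)
  qed (use B in \<open>auto simp: multinomial_process_def\<close>)
  moreover have "gen_sigma M UNIV ?X \<subseteq> gen_sigma M UNIV ?B"
    \<comment> \<open>Independence is assumed for the triples of natural numbers; the integer
      triples are functions of them and carry no further information.\<close>
    using gen_sigma_comp[of M UNIV "\<lambda>(a, b, c). (int a, int b, int c)" ?B] by simp
  ultimately have D: "iid_steps M (gen_sigma M UNIV ?B) n D \<delta>" for n
    by (rule iid_steps_mono)
  let ?\<psi> = "\<lambda>n f \<omega>. success_index n (\<lambda>j. f (D j \<omega>) = (1 :: int))"
  let ?\<psi>0 = "\<lambda>n. ?\<psi> n fst" and ?\<psi>1 = "\<lambda>n. ?\<psi> n (\<lambda>d. fst (snd d))"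
    and ?\<psi>2 = "\<lambda>n. ?\<psi> n (\<lambda>d. snd (snd d))"
  \<comment> \<open>If a counter does not move at step \<open>i\<close>, its entry holds a claim
    with index \<open>n + i\<close>, which \<open>claim\<close> multiplies by 0.\<close>
  define W where "W = (\<lambda>n i \<omega>. (((D i \<omega>, Y 1 (?\<psi>1 n \<omega> i) \<omega>),
    Y 2 (?\<psi>2 n \<omega> i) \<omega>),
    (Y 3 (?\<psi>0 n \<omega> i) \<omega>, Y 4 (?\<psi>0 n \<omega> i) \<omega>)))"
  have W: "iid_steps M events n (W n) (pair_pmf (pair_pmf (pair_pmf \<delta> q1) q2) q34)" for n
  proof -
    have "indep_steps M [gen_sigma M {1..} (Y 1), gen_sigma M {1..} (Y 2),
        gen_sigma M {1..} (\<lambda>i \<omega>. (Y 3 i \<omega>, Y 4 i \<omega>))] n D \<delta>"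
      unfolding indep_steps_def using ind D sigma_algebra_gen_sigma by blast
    \<comment> \<open>The clock is read from the accumulated tuple, in which \<open>D\<close> lies
      one \<open>fst\<close> deeper after each absorbed family.\<close>
    from indep_steps_extend[OF this _ iid_Y(1) q1, of "\<lambda>d. fst (snd d) = 1"]
    have "indep_steps M [gen_sigma M {1..} (Y 2), gen_sigma M {1..} (\<lambda>i \<omega>. (Y 3 i \<omega>, Y 4 i \<omega>))] n
        (\<lambda>i \<omega>. (D i \<omega>, Y 1 (?\<psi>1 n \<omega> i) \<omega>)) (pair_pmf \<delta> q1)"
      by (simp add: sigma_algebra_gen_sigma)
    from indep_steps_extend[OF this _ iid_Y(2) q2, of "\<lambda>d. snd (snd (fst d)) = 1"]
    have "indep_steps M [gen_sigma M {1..} (\<lambda>i \<omega>. (Y 3 i \<omega>, Y 4 i \<omega>))] n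
        (\<lambda>i \<omega>. ((D i \<omega>, Y 1 (?\<psi>1 n \<omega> i) \<omega>), Y 2 (?\<psi>2 n \<omega> i) \<omega>))
        (pair_pmf (pair_pmf \<delta> q1) q2)"
      by (simp add: sigma_algebra_gen_sigma)
    from indep_steps_extend[OF this _ iid_Y(3) q34, of "\<lambda>d. fst (fst (fst d)) = 1"]
    have "indep_steps M [] n (W n) (pair_pmf (pair_pmf (pair_pmf \<delta> q1) q2) q34)"
      by (simp add: W_def)
    then show ?thesis
      by (rule indep_steps_iid_steps)
  qed
  show ?thesis
    unfolding claim_law_def
  proof (rule walkI[OF _ W order.refl])
    show "(\<lambda>\<omega>. (S1 t \<omega>, S2 t \<omega>)) \<in> measurable M (count_space UNIV)" for t
      unfolding S1 S2
      by (intro measurable_count_space_binop[where h = Pair]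
          measurable_count_space_binop[where h = "(+)"]
          measurable_count_space_random_sum Bm claim_sizes_measurable[OF Y]) auto
    fix n
    have D_AE: "AE \<omega> in M. \<forall>i\<in>{1..n}. D i \<omega> \<in> set_pmf \<delta>"
      by (rule iid_steps_AE[OF D]) (rule mutually_indep_events[OF ind], simp)
    have supp: "set_pmf \<delta> \<subseteq> {(0, 0, 0), (1, 0, 0), (0, 1, 0), (0, 0, 1)}"
      using multinomial_step_law[OF B \<delta>] by (auto simp: set_pmf_eq split: if_splits)
    show "AE \<omega> in M. \<forall>t\<le>n. (S1 t \<omega>, S2 t \<omega>) =
        (\<Sum>i=1..t. (\<lambda>(((d, y1), y2), y34). claim d y1 y2 y34) (W n i \<omega>))"
      using D_AE B_zero AE_space
    proof eventually_elim
      case (elim \<omega>)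
      have d: "fst (D i \<omega>) \<in> {0, 1}" "fst (snd (D i \<omega>)) \<in> {0, 1}" "snd (snd (D i \<omega>)) \<in> {0, 1}"
        if "i \<in> {1..n}" for i
        using elim(1) supp that by fastforce+
      have B': "int (B0 i \<omega>) - int (B0 (i - 1) \<omega>) = fst (D i \<omega>)"
          "int (B1 i \<omega>) - int (B1 (i - 1) \<omega>) = fst (snd (D i \<omega>))"
          "int (B2 i \<omega>) - int (B2 (i - 1) \<omega>) = snd (snd (D i \<omega>))" for i
        by (simp_all add: D_def)
      show ?case
      proof (intro allI impI)
        fix t assume t: "t \<le> n"
        have sum: "(\<Sum>i=0..B1 t \<omega>. Y 1 i \<omega>) =
              (\<Sum>i=1..t. fst (snd (D i \<omega>)) * Y 1 (?\<psi>1 n \<omega> i) \<omega>)"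
            "(\<Sum>i=0..B2 t \<omega>. Y 2 i \<omega>) =
              (\<Sum>i=1..t. snd (snd (D i \<omega>)) * Y 2 (?\<psi>2 n \<omega> i) \<omega>)"
            "(\<Sum>i=0..B0 t \<omega>. Y 3 i \<omega>) =
              (\<Sum>i=1..t. fst (D i \<omega>) * Y 3 (?\<psi>0 n \<omega> i) \<omega>)"
            "(\<Sum>i=0..B0 t \<omega>. Y 4 i \<omega>) =
              (\<Sum>i=1..t. fst (D i \<omega>) * Y 4 (?\<psi>0 n \<omega> i) \<omega>)"
          using sum_counting_path_int[of "\<lambda>t. B1 t \<omega>" n t "\<lambda>i. Y 1 i \<omega>", unfolded B',
              OF _ d(2) t]
            sum_counting_path_int[of "\<lambda>t. B2 t \<omega>" n t "\<lambda>i. Y 2 i \<omega>", unfolded B', OF _ d(3) t]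
            sum_counting_path_int[of "\<lambda>t. B0 t \<omega>" n t "\<lambda>i. Y 3 i \<omega>", unfolded B', OF _ d(1) t]
            sum_counting_path_int[of "\<lambda>t. B0 t \<omega>" n t "\<lambda>i. Y 4 i \<omega>", unfolded B', OF _ d(1) t]
            elim(2,3) Y0
          by simp_all
        show "(S1 t \<omega>, S2 t \<omega>) =
            (\<Sum>i=1..t. (\<lambda>(((d, y1), y2), y34). claim d y1 y2 y34) (W n i \<omega>))"
          unfolding S1 S2 sum W_def claim_def
          by (simp add: sum_prod sum.distrib split_beta)
      qed
    qed
  qed
qed

section \<open>Thinning, and the identity of the step laws\<close>

definition scale_claim :: "int \<Rightarrow> int \<times> int \<Rightarrow> int \<times> int" where
  "scale_claim b x = (b * fst x, b * snd x)"

definition bernoulli_int :: "real \<Rightarrow> int pmf" where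
  "bernoulli_int p = map_pmf of_bool (bernoulli_pmf p)"

text \<open>The law of one step of a compound binomial process whose pairs have law
  \<open>\<kappa>\<close>: for \<open>p\<close> in the unit interval, zero with probability
  \<open>1 - p\<close> and a pair with law \<open>\<kappa>\<close> otherwise.\<close>

definition thinned_law :: "real \<Rightarrow> (int \<times> int) pmf \<Rightarrow> (int \<times> int) pmf" where
  "thinned_law p \<kappa> = map_pmf (\<lambda>(b, x). scale_claim b x) (pair_pmf (bernoulli_int p) \<kappa>)"

text \<open>
  Steps of the multinomial process are ordered as \<open>(B0, B1, B2)\<close>, the indicator vectors as
  \<open>(I1, I2, I0)\<close>.
\<close>

definition step_of_mark :: "int \<times> int \<times> int \<Rightarrow> int \<times> int \<times> int" where
  "step_of_mark i = (case i of (i1, i2, i0) \<Rightarrow> (i0, i1, i2))"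

definition mark_probs :: "real \<Rightarrow> real \<Rightarrow> real \<Rightarrow> (int \<times> int \<times> int) pmf \<Rightarrow> bool" where
  "mark_probs p0 p1 p2 \<iota> \<longleftrightarrow>
     pmf \<iota> (1, 0, 0) = p1 / (p0 + p1 + p2) \<and> pmf \<iota> (0, 1, 0) = p2 / (p0 + p1 + p2) \<and>
     pmf \<iota> (0, 0, 1) = p0 / (p0 + p1 + p2)"

text \<open>Only three probabilities are prescribed, but they add up to one, so no other mark has
  positive mass.\<close>

lemma mark_probs_support:
  assumes "mark_probs p0 p1 p2 \<iota>" and "p0 + p1 + p2 > 0"
  shows "set_pmf \<iota> \<subseteq> {(1, 0, 0), (0, 1, 0), (0, 0, 1)}"
proof -
  have "measure_pmf.prob \<iota> {(1, 0, 0), (0, 1, 0), (0, 0, 1)} = 1"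
    using assms
    by (simp add: mark_probs_def measure_measure_pmf_finite flip: add_divide_distrib)
  then show ?thesis
    by (simp add: measure_pmf.prob_eq_1 AE_measure_pmf_iff subset_iff)
qed

text \<open>Rests on \<open>p1 = p * (p1 / p)\<close> and its analogues: a step vanishes with
  probability \<open>1 - p\<close> and otherwise chooses its type by the mark law.\<close>

lemma multinomial_step_mixture:
  assumes \<iota>: "mark_probs p0 p1 p2 \<iota>" and p: "p = p0 + p1 + p2" "0 < p" "p \<le> 1"
    and \<delta>: "\<And>d0 d1 d2. pmf \<delta> (d0, d1, d2) =
      (if (d0, d1, d2) = (0, 0, 0) then 1 - (p0 + p1 + p2)
       else if (d0, d1, d2) = (1, 0, 0) then p0
       else if (d0, d1, d2) = (0, 1, 0) then p1
       else if (d0, d1, d2) = (0, 0, 1) then p2 else 0)"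
  shows "\<delta> = bernoulli_pmf p \<bind> (\<lambda>c. if c then map_pmf step_of_mark \<iota> else return_pmf (0, 0, 0))"
proof (rule pmf_eqI)
  fix d :: "int \<times> int \<times> int"
  obtain d0 d1 d2 where d: "d = (d0, d1, d2)"
    by (cases d)
  have "inj step_of_mark"
    by (auto simp: inj_on_def step_of_mark_def)
  then have "pmf (map_pmf step_of_mark \<iota>) (step_of_mark (d1, d2, d0)) = pmf \<iota> (d1, d2, d0)"
    by (rule pmf_map_inj')
  then have pmf_mark: "pmf (map_pmf step_of_mark \<iota>) d = pmf \<iota> (d1, d2, d0)"
    by (simp add: step_of_mark_def d)
  have zero: "pmf \<iota> x = 0" if "x \<notin> {(1, 0, 0), (0, 1, 0), (0, 0, 1)}" for x
    using mark_probs_support[OF \<iota>] p that by (auto simp: set_pmf_iff)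
  have vals: "p * pmf \<iota> (1, 0, 0) = p1" "p * pmf \<iota> (0, 1, 0) = p2" "p * pmf \<iota> (0, 0, 1) = p0"
    using \<iota> \<open>0 < p\<close> unfolding mark_probs_def p(1) by simp_all
  have "pmf (bernoulli_pmf p \<bind> (\<lambda>c. if c then map_pmf step_of_mark \<iota> else return_pmf (0, 0, 0))) d =
      p * pmf \<iota> (d1, d2, d0) + (1 - p) * pmf (return_pmf (0, 0, 0)) d"
    using p(2,3) by (simp add: pmf_bind pmf_mark)
  also have "\<dots> = pmf \<delta> d"
  proof -
    consider "d = (0, 0, 0)" | "d = (1, 0, 0)" | "d = (0, 1, 0)" | "d = (0, 0, 1)"
      | "d \<notin> {(0, 0, 0), (1, 0, 0), (0, 1, 0), (0, 0, 1)}"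
      by blast
    then show ?thesis
    proof cases
      case 5
      then have "pmf \<iota> (d1, d2, d0) = 0"
        by (intro zero) (auto simp: d)
      then show ?thesis
        using 5 by (auto simp: d \<delta>)
    qed (use vals p(1) zero[of "(0, 0, 0)"] in \<open>simp_all add: d \<delta>\<close>)
  qed
  finally show "pmf \<delta> d =
      pmf (bernoulli_pmf p \<bind> (\<lambda>c. if c then map_pmf step_of_mark \<iota> else return_pmf (0, 0, 0))) d"
    by (rule sym)
qed

text \<open>\<open>claim_law\<close> commutes with mixtures of step laws, so the coin toss can be
  taken out. The zero step yields the zero claim whatever claims are drawn, so its part collapses to
  a point mass.\<close>

lemma claim_law_mixture:
  assumes "\<delta> = bernoulli_pmf p \<bind> (\<lambda>c. if c then map_pmf step_of_mark \<iota> else return_pmf (0, 0, 0))"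
  shows "claim_law \<delta> q1 q2 q34 = thinned_law p (claim_law (map_pmf step_of_mark \<iota>) q1 q2 q34)"
proof -
  have "claim_law (return_pmf (0, 0, 0)) q1 q2 q34 = return_pmf (0, 0)"
    unfolding claim_law_def claim_def pair_pmf_def map_pmf_def bind_assoc_pmf bind_return_pmf
    by (simp add: bind_pmf_const)
  moreover have "claim_law \<delta> q1 q2 q34 =
      bernoulli_pmf p \<bind> (\<lambda>c. claim_law (if c then map_pmf step_of_mark \<iota> else return_pmf (0, 0, 0)) q1 q2 q34)"
    unfolding assms claim_law_def pair_pmf_def map_pmf_def bind_assoc_pmf ..
  moreover have "thinned_law p \<kappa> =
      bernoulli_pmf p \<bind> (\<lambda>c. if c then \<kappa> else return_pmf (0, 0))" for \<kappa>
    unfolding thinned_law_def bernoulli_int_def pair_pmf_def map_pmf_def bind_assoc_pmf bind_return_pmf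
    by (intro bind_pmf_cong refl) (simp add: scale_claim_def bind_return_pmf' bind_pmf_const)
  ultimately show ?thesis
    by (auto intro!: bind_pmf_cong)
qed

section \<open>Sums of marked claims\<close>

text \<open>The pair summed in the type I representation: the mark selects a claim in one coordinate
  only, or the dependent claims in both.\<close>

definition marked_claim ::
    "(nat \<Rightarrow> nat \<Rightarrow> 'a \<Rightarrow> int) \<Rightarrow> (nat \<Rightarrow> nat \<Rightarrow> 'a \<Rightarrow> int) \<Rightarrow> nat \<Rightarrow> 'a \<Rightarrow> int \<times> int" where
  "marked_claim I Y n \<omega> =
     (I 1 n \<omega> * Y 1 n \<omega> + I 0 n \<omega> * Y 3 n \<omega>, I 2 n \<omega> * Y 2 n \<omega> + I 0 n \<omega> * Y 4 n \<omega>)"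

lemma measurable_marked_claim:
  assumes "prob_space M" and Y: "claim_sizes M Y"
    and I: "iid M (\<lambda>i \<omega>. (I 1 i \<omega>, I 2 i \<omega>, I 0 i \<omega>))" and "n \<ge> 1"
  shows "marked_claim I Y n \<in> measurable M (count_space UNIV)"
proof -
  have Im: "(\<lambda>\<omega>. (I 1 n \<omega>, I 2 n \<omega>, I 0 n \<omega>)) \<in> measurable M (count_space UNIV)"
    using prob_space.iid_measurable[OF assms(1) I \<open>n \<ge> 1\<close>] .
  have Ym: "Y k n \<in> measurable M (count_space UNIV)" if "k \<in> {1..4}" for k
    using Y that by (rule claim_sizes_measurable)
  have Y12: "(\<lambda>\<omega>. (Y 1 n \<omega>, Y 2 n \<omega>)) \<in> measurable M (count_space UNIV)"
    by (rule measurable_count_space_binop[where h = Pair, OF Ym Ym]) auto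
  have Y34: "(\<lambda>\<omega>. (Y 3 n \<omega>, Y 4 n \<omega>)) \<in> measurable M (count_space UNIV)"
    by (rule measurable_count_space_binop[where h = Pair, OF Ym Ym]) auto
  have Y: "(\<lambda>\<omega>. ((Y 1 n \<omega>, Y 2 n \<omega>), (Y 3 n \<omega>, Y 4 n \<omega>))) \<in> measurable M (count_space UNIV)"
    by (rule measurable_count_space_binop[where h = Pair, OF Y12 Y34])
  define h :: "int \<times> int \<times> int \<Rightarrow> (int \<times> int) \<times> int \<times> int \<Rightarrow> int \<times> int"
    where "h i y = (fst i * fst (fst y) + snd (snd i) * fst (snd y),
      fst (snd i) * snd (fst y) + snd (snd i) * snd (snd y))" for i y
  have eq: "marked_claim I Y n =
      (\<lambda>\<omega>. h (I 1 n \<omega>, I 2 n \<omega>, I 0 n \<omega>) ((Y 1 n \<omega>, Y 2 n \<omega>), (Y 3 n \<omega>, Y 4 n \<omega>)))"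
    by (simp add: fun_eq_iff marked_claim_def h_def)
  show ?thesis
    unfolding eq by (rule measurable_count_space_binop[OF Im Y])
qed

text \<open>\<open>D\<close> decides whether a step carries a claim, and \<open>c\<close> determines
  its index: numbering the successes gives sums up to a binomial time, a constantly true clock gives
  sums thinned by events. The mark and all claims of a step are read at the same index.\<close>

lemma (in prob_space) walk_marked:
  fixes I Y :: "nat \<Rightarrow> nat \<Rightarrow> 'a \<Rightarrow> int"
  assumes ind: "mutually_indep M [F, gen_sigma M {1..} (\<lambda>i \<omega>. (I 1 i \<omega>, I 2 i \<omega>, I 0 i \<omega>)),
      gen_sigma M {1..} (Y 1), gen_sigma M {1..} (Y 2),
      gen_sigma M {1..} (\<lambda>i \<omega>. (Y 3 i \<omega>, Y 4 i \<omega>))]"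
    and F: "sigma_algebra (space M) F"
    and D: "\<And>n. iid_steps M F n D (bernoulli_int p)"
    and Y: "claim_sizes M Y"
    and I: "iid M (\<lambda>i \<omega>. (I 1 i \<omega>, I 2 i \<omega>, I 0 i \<omega>))"
    and \<iota>: "distr M (count_space UNIV) (\<lambda>\<omega>. (I 1 1 \<omega>, I 2 1 \<omega>, I 0 1 \<omega>)) = measure_pmf \<iota>"
    and q1: "distr M (count_space UNIV) (Y 1 1) = measure_pmf q1"
    and q2: "distr M (count_space UNIV) (Y 2 1) = measure_pmf q2"
    and q34: "distr M (count_space UNIV) (\<lambda>\<omega>. (Y 3 1 \<omega>, Y 4 1 \<omega>)) = measure_pmf q34"
    and S_meas: "\<And>t. S t \<in> measurable M (count_space UNIV)"
    and S: "\<And>n. AE \<omega> in M. \<forall>t\<le>n. S t \<omega> =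
      (\<Sum>i=1..t. scale_claim (D i \<omega>) (marked_claim I Y (success_index n (\<lambda>j. c (D j \<omega>)) i) \<omega>))"
  shows "walk M (thinned_law p (claim_law (map_pmf step_of_mark \<iota>) q1 q2 q34)) S"
proof -
  let ?w = "pair_pmf (pair_pmf (pair_pmf (pair_pmf (bernoulli_int p) \<iota>) q1) q2) q34"
  let ?h = "\<lambda>((((b, i), y1), y2), y34). scale_claim b (claim (step_of_mark i) y1 y2 y34)"
  have iid_Y: "iid M (Y 1)" "iid M (Y 2)" "iid M (\<lambda>i \<omega>. (Y 3 i \<omega>, Y 4 i \<omega>))"
    using Y by (auto simp: claim_sizes_def)
  define W where "W = (\<lambda>n i \<omega>. let k = success_index n (\<lambda>j. c (D j \<omega>)) i in
    ((((D i \<omega>, (I 1 k \<omega>, I 2 k \<omega>, I 0 k \<omega>)), Y 1 k \<omega>), Y 2 k \<omega>), (Y 3 k \<omega>, Y 4 k \<omega>)))"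
  have W: "iid_steps M events n (W n) ?w" for n
  proof -
    let ?k = "\<lambda>\<omega>. success_index n (\<lambda>j. c (D j \<omega>))"
    have "indep_steps M [gen_sigma M {1..} (\<lambda>i \<omega>. (I 1 i \<omega>, I 2 i \<omega>, I 0 i \<omega>)),
        gen_sigma M {1..} (Y 1), gen_sigma M {1..} (Y 2),
        gen_sigma M {1..} (\<lambda>i \<omega>. (Y 3 i \<omega>, Y 4 i \<omega>))] n D (bernoulli_int p)"
      unfolding indep_steps_def using ind D F by blast
    from indep_steps_extend[OF this _ I \<iota>, of c]
    have "indep_steps M [gen_sigma M {1..} (Y 1), gen_sigma M {1..} (Y 2),
        gen_sigma M {1..} (\<lambda>i \<omega>. (Y 3 i \<omega>, Y 4 i \<omega>))] n
        (\<lambda>i \<omega>. (D i \<omega>, (I 1 (?k \<omega> i) \<omega>, I 2 (?k \<omega> i) \<omega>, I 0 (?k \<omega> i) \<omega>)))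
        (pair_pmf (bernoulli_int p) \<iota>)"
      by (simp add: sigma_algebra_gen_sigma)
    from indep_steps_extend[OF this _ iid_Y(1) q1, of "\<lambda>z. c (fst z)"]
    have "indep_steps M [gen_sigma M {1..} (Y 2),
        gen_sigma M {1..} (\<lambda>i \<omega>. (Y 3 i \<omega>, Y 4 i \<omega>))] n
        (\<lambda>i \<omega>. ((D i \<omega>, (I 1 (?k \<omega> i) \<omega>, I 2 (?k \<omega> i) \<omega>, I 0 (?k \<omega> i) \<omega>)), Y 1 (?k \<omega> i) \<omega>))
        (pair_pmf (pair_pmf (bernoulli_int p) \<iota>) q1)"
      by (simp add: sigma_algebra_gen_sigma)
    from indep_steps_extend[OF this _ iid_Y(2) q2, of "\<lambda>z. c (fst (fst z))"]
    have "indep_steps M [gen_sigma M {1..} (\<lambda>i \<omega>. (Y 3 i \<omega>, Y 4 i \<omega>))] n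
        (\<lambda>i \<omega>. (((D i \<omega>, (I 1 (?k \<omega> i) \<omega>, I 2 (?k \<omega> i) \<omega>, I 0 (?k \<omega> i) \<omega>)), Y 1 (?k \<omega> i) \<omega>),
          Y 2 (?k \<omega> i) \<omega>))
        (pair_pmf (pair_pmf (pair_pmf (bernoulli_int p) \<iota>) q1) q2)"
      by (simp add: sigma_algebra_gen_sigma)
    from indep_steps_extend[OF this _ iid_Y(3) q34, of "\<lambda>z. c (fst (fst (fst z)))"]
    have "indep_steps M [] n (W n) ?w"
      by (simp add: W_def Let_def)
    then show ?thesis
      by (rule indep_steps_iid_steps)
  qed
  have h: "?h (W n i \<omega>) = scale_claim (D i \<omega>) (marked_claim I Y (success_index n (\<lambda>j. c (D j \<omega>)) i) \<omega>)" for n i \<omega>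
    by (simp add: W_def Let_def step_of_mark_def claim_def marked_claim_def)
  have "walk M (map_pmf ?h ?w) S"
    by (rule walkI[OF S_meas W order.refl]) (use S in \<open>simp only: h\<close>)
  \<comment> \<open>Both sides draw the same independent variables in the same order; flattening the
    binds makes this visible.\<close>
  also have "map_pmf ?h ?w = thinned_law p (claim_law (map_pmf step_of_mark \<iota>) q1 q2 q34)"
    unfolding thinned_law_def claim_law_def pair_pmf_def map_pmf_def bind_assoc_pmf bind_return_pmf
    by (simp only: case_prod_conv)
  finally show ?thesis .
qed

lemma (in prob_space) binomial_process_steps:
  assumes B: "binomial_process M p B"
  shows "iid_steps M (gen_sigma M UNIV B) n (\<lambda>i \<omega>. int (B i \<omega>) - int (B (i - 1) \<omega>)) (bernoulli_int p)"
proof (rule iid_steps_mono)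
  have Bm: "B t \<in> measurable M (count_space UNIV)" for t
    using B by (simp add: binomial_process_def)
  show "iid_steps M (gen_sigma M UNIV (\<lambda>t \<omega>. int (B t \<omega>))) n
      (\<lambda>i \<omega>. int (B i \<omega>) - int (B (i - 1) \<omega>)) (bernoulli_int p)"
  proof (rule iid_steps_increments)
    show "(\<lambda>\<omega>. int (B t \<omega>)) \<in> measurable M (count_space UNIV)" for t
      by (rule measurable_compose[OF Bm]) simp
    have "distr M (count_space UNIV) (\<lambda>\<omega>. int (B 1 \<omega>)) =
        distr (distr M (count_space UNIV) (B 1)) (count_space UNIV) int"
      using Bm by (simp add: distr_distr comp_def)
    also have "\<dots> = measure_pmf (map_pmf int (binomial_pmf 1 p))"
      using B by (simp add: binomial_process_def map_pmf_rep_eq)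
    also have "map_pmf int (binomial_pmf 1 p) = bernoulli_int p"
      using B by (auto simp: binomial_process_def bernoulli_int_def binomial_pmf_Suc map_pmf_def
          bind_assoc_pmf bind_return_pmf binomial_pmf_0 intro!: bind_pmf_cong)
    finally show "distr M (count_space UNIV) (\<lambda>\<omega>. int (B 1 \<omega>)) = measure_pmf (bernoulli_int p)" .
  qed (use B in \<open>auto simp: binomial_process_def\<close>)
qed (rule gen_sigma_comp)

text \<open>The increments are almost surely 0 or 1, so scaling a summand by an increment means
  keeping or dropping it.\<close>

lemma (in prob_space) binomial_process_path:
  fixes x :: "nat \<Rightarrow> 'a \<Rightarrow> int \<times> int"
  assumes B: "binomial_process M p B"
  shows "AE \<omega> in M. \<forall>t\<le>n. (\<Sum>j=1..B t \<omega>. x j \<omega>) =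
    (\<Sum>i=1..t. scale_claim (int (B i \<omega>) - int (B (i - 1) \<omega>))
      (x (success_index n (\<lambda>j. int (B j \<omega>) - int (B (j - 1) \<omega>) = 1) i) \<omega>))"
proof -
  have "gen_sigma M UNIV B \<subseteq> events"
    using B by (intro gen_sigma_events) (simp add: binomial_process_def)
  note iid_steps_AE[OF binomial_process_steps[OF B] this, of n]
  moreover have "AE \<omega> in M. B 0 \<omega> = 0"
    using B by (simp add: binomial_process_def)
  ultimately show ?thesis
  proof eventually_elim
    case (elim \<omega>)
    have D: "int (B i \<omega>) - int (B (i - 1) \<omega>) \<in> {0, 1}" if "i \<in> {1..n}" for i
      using elim(1)[rule_format, OF that] by (auto simp: bernoulli_int_def)
    show ?case
    proof (intro allI impI)
      fix t assume t: "t \<le> n"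
      have "(\<Sum>j=1..B t \<omega>. x j \<omega>) =
        (\<Sum>i=1..t. if int (B i \<omega>) - int (B (i - 1) \<omega>) = 1
          then x (success_index n (\<lambda>j. int (B j \<omega>) - int (B (j - 1) \<omega>) = 1) i) \<omega> else 0)"
        by (rule sum_counting_path[where N = "\<lambda>t. B t \<omega>" and y = "\<lambda>j. x j \<omega>", OF elim(2) D t])
      also have "\<dots> =
        (\<Sum>i=1..t. scale_claim (int (B i \<omega>) - int (B (i - 1) \<omega>))
          (x (success_index n (\<lambda>j. int (B j \<omega>) - int (B (j - 1) \<omega>) = 1) i) \<omega>))"
      proof (rule sum.cong[OF refl])
        fix i assume "i \<in> {1..t}"
        with t have "i \<in> {1..n}"
          by simp
        from D[OF this]
        show "(if int (B i \<omega>) - int (B (i - 1) \<omega>) = 1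
            then x (success_index n (\<lambda>j. int (B j \<omega>) - int (B (j - 1) \<omega>) = 1) i) \<omega> else 0) =
          scale_claim (int (B i \<omega>) - int (B (i - 1) \<omega>))
            (x (success_index n (\<lambda>j. int (B j \<omega>) - int (B (j - 1) \<omega>) = 1) i) \<omega>)"
          by (elim insertE) (simp_all add: scale_claim_def zero_prod_def)
      qed
      finally show "(\<Sum>j=1..B t \<omega>. x j \<omega>) =
        (\<Sum>i=1..t. scale_claim (int (B i \<omega>) - int (B (i - 1) \<omega>))
          (x (success_index n (\<lambda>j. int (B j \<omega>) - int (B (j - 1) \<omega>) = 1) i) \<omega>))" .
    qed
  qed
qed

text \<open>The terms with \<open>n = 0\<close> vanish because the claims of index 0 do, whatever
  values the other factors take there.\<close>

lemma sum_marked_claim: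
  assumes "claim_sizes M Y" and "\<omega> \<in> space M"
  shows "(\<Sum>n=0..m. I 1 n \<omega> * Y 1 n \<omega> + I 0 n \<omega> * Y 3 n \<omega>,
          \<Sum>n=0..m. I 2 n \<omega> * Y 2 n \<omega> + I 0 n \<omega> * Y 4 n \<omega>) =
         (\<Sum>n=1..m. marked_claim I Y n \<omega>)"
    and "(\<Sum>n=0..m. e n * (I 1 n \<omega> * Y 1 n \<omega> + I 0 n \<omega> * Y 3 n \<omega>),
          \<Sum>n=0..m. e n * (I 2 n \<omega> * Y 2 n \<omega> + I 0 n \<omega> * Y 4 n \<omega>)) =
         (\<Sum>n=1..m. scale_claim (e n) (marked_claim I Y n \<omega>))"
proof -
  have "Y k 0 \<omega> = 0" if "k \<in> {1..4}" for k
    using assms that by (simp add: claim_sizes_def)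
  then show
    "(\<Sum>n=0..m. I 1 n \<omega> * Y 1 n \<omega> + I 0 n \<omega> * Y 3 n \<omega>,
      \<Sum>n=0..m. I 2 n \<omega> * Y 2 n \<omega> + I 0 n \<omega> * Y 4 n \<omega>) = (\<Sum>n=1..m. marked_claim I Y n \<omega>)"
    "(\<Sum>n=0..m. e n * (I 1 n \<omega> * Y 1 n \<omega> + I 0 n \<omega> * Y 3 n \<omega>),
      \<Sum>n=0..m. e n * (I 2 n \<omega> * Y 2 n \<omega> + I 0 n \<omega> * Y 4 n \<omega>)) =
      (\<Sum>n=1..m. scale_claim (e n) (marked_claim I Y n \<omega>))"
    by (simp_all add: marked_claim_def scale_claim_def sum_prod sum_atLeast0_drop)
qed

lemma (in prob_space) walk_binomial_marked:
  fixes I Y :: "nat \<Rightarrow> nat \<Rightarrow> 'a \<Rightarrow> int"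
  assumes ind: "mutually_indep M [gen_sigma M UNIV B,
      gen_sigma M {1..} (\<lambda>i \<omega>. (I 1 i \<omega>, I 2 i \<omega>, I 0 i \<omega>)),
      gen_sigma M {1..} (Y 1), gen_sigma M {1..} (Y 2),
      gen_sigma M {1..} (\<lambda>i \<omega>. (Y 3 i \<omega>, Y 4 i \<omega>))]"
    and B: "binomial_process M p B" and Y: "claim_sizes M Y"
    and I: "iid M (\<lambda>i \<omega>. (I 1 i \<omega>, I 2 i \<omega>, I 0 i \<omega>))"
    and laws: "distr M (count_space UNIV) (\<lambda>\<omega>. (I 1 1 \<omega>, I 2 1 \<omega>, I 0 1 \<omega>)) = measure_pmf \<iota>"
      "distr M (count_space UNIV) (Y 1 1) = measure_pmf q1"
      "distr M (count_space UNIV) (Y 2 1) = measure_pmf q2"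
      "distr M (count_space UNIV) (\<lambda>\<omega>. (Y 3 1 \<omega>, Y 4 1 \<omega>)) = measure_pmf q34"
  shows "walk M (thinned_law p (claim_law (map_pmf step_of_mark \<iota>) q1 q2 q34))
    (\<lambda>t \<omega>. (\<Sum>n=0..B t \<omega>. I 1 n \<omega> * Y 1 n \<omega> + I 0 n \<omega> * Y 3 n \<omega>,
            \<Sum>n=0..B t \<omega>. I 2 n \<omega> * Y 2 n \<omega> + I 0 n \<omega> * Y 4 n \<omega>))" (is "walk M _ ?S")
proof (rule walk_marked[OF ind sigma_algebra_gen_sigma binomial_process_steps[OF B] Y I laws,
      where c = "\<lambda>b. b = 1"])
  have S: "?S t \<omega> = (\<Sum>n=1..B t \<omega>. marked_claim I Y n \<omega>)" if "\<omega> \<in> space M" for t \<omega>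
    by (rule sum_marked_claim[OF Y that])
  have "(\<lambda>\<omega>. \<Sum>n=1..B t \<omega>. marked_claim I Y n \<omega>) \<in> measurable M (count_space UNIV)" for t
    using B measurable_marked_claim[OF prob_space_axioms Y I]
    by (intro measurable_count_space_random_sum) (auto simp: binomial_process_def)
  moreover have "?S t \<in> measurable M (count_space UNIV) \<longleftrightarrow>
      (\<lambda>\<omega>. \<Sum>n=1..B t \<omega>. marked_claim I Y n \<omega>) \<in> measurable M (count_space UNIV)" for t
    by (rule measurable_cong) (rule S)
  ultimately show "?S t \<in> measurable M (count_space UNIV)" for t
    by blast
  fix n
  show "AE \<omega> in M. \<forall>t\<le>n. ?S t \<omega> =
      (\<Sum>i=1..t. scale_claim (int (B i \<omega>) - int (B (i - 1) \<omega>)) (marked_claim I Y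
        (success_index n (\<lambda>j. int (B j \<omega>) - int (B (j - 1) \<omega>) = 1) i) \<omega>))"
    using binomial_process_path[OF B, of n "marked_claim I Y"] AE_space
    by eventually_elim (simp only: S)
qed

lemma (in prob_space) bernoulli_events_law:
  assumes A: "bernoulli_events M p A"
  shows "distr M (count_space UNIV) (indicator (A 1) :: 'a \<Rightarrow> int) = measure_pmf (bernoulli_int p)"
proof -
  have iid: "iid M (\<lambda>i. indicator (A i) :: 'a \<Rightarrow> int)" and A1: "A 1 \<in> events" "prob (A 1) = p"
    using A by (auto simp: bernoulli_events_def)
  have ind: "(indicator (A 1) :: 'a \<Rightarrow> int) \<in> measurable M (count_space UNIV)"
    using iid_measurable[OF iid, of 1] by simp
  then obtain q where q: "distr M (count_space UNIV) (indicator (A 1) :: 'a \<Rightarrow> int) = measure_pmf q"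
    by (rule distr_eq_pmf)
  have p: "p \<in> {0..1}"
    using A1 by auto
  have "q = bernoulli_int p"
  proof (rule pmf_eqI)
    fix x :: int
    consider "x = 1" | "x = 0" | "x \<notin> {0, 1}"
      by auto
    then show "pmf q x = pmf (bernoulli_int p) x"
    proof cases
      case 1
      have "of_bool -` {1 :: int} = {True}" "{\<omega> \<in> space M. indicator (A 1) \<omega> = (1 :: int)} = A 1"
        using sets.sets_into_space[OF A1(1)] by (auto simp: indicator_def)
      then show ?thesis
        using A1 p 1 by (simp add: pmf_eq_prob[OF ind q] bernoulli_int_def pmf_map measure_pmf_single)
    next
      case 2
      have "of_bool -` {0 :: int} = {False}"
          "{\<omega> \<in> space M. indicator (A 1) \<omega> = (0 :: int)} = space M - A 1"
        by (auto simp: indicator_def)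
      then show ?thesis
        using A1 p 2
        by (simp add: pmf_eq_prob[OF ind q] bernoulli_int_def pmf_map measure_pmf_single prob_compl)
    next
      case 3
      then have "of_bool -` {x} = {}" "{\<omega> \<in> space M. indicator (A 1) \<omega> = x} = {}"
        by (auto simp: indicator_def)
      then show ?thesis
        unfolding pmf_eq_prob[OF ind q] bernoulli_int_def pmf_map by (simp only: measure_empty)
    qed
  qed
  with q show ?thesis
    by simp
qed

text \<open>The indicators of the events are already independent steps with one law, so nothing is
  relabelled: the constantly true clock makes \<open>success_index\<close> the identity.\<close>

lemma (in prob_space) walk_bernoulli_marked:
  fixes I Y :: "nat \<Rightarrow> nat \<Rightarrow> 'a \<Rightarrow> int"
  assumes ind: "mutually_indep M [gen_sigma M {1..} (\<lambda>i. indicator (A i) :: 'a \<Rightarrow> int),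
      gen_sigma M {1..} (\<lambda>i \<omega>. (I 1 i \<omega>, I 2 i \<omega>, I 0 i \<omega>)),
      gen_sigma M {1..} (Y 1), gen_sigma M {1..} (Y 2),
      gen_sigma M {1..} (\<lambda>i \<omega>. (Y 3 i \<omega>, Y 4 i \<omega>))]"
    and A: "bernoulli_events M p A" and Y: "claim_sizes M Y"
    and I: "iid M (\<lambda>i \<omega>. (I 1 i \<omega>, I 2 i \<omega>, I 0 i \<omega>))"
    and laws: "distr M (count_space UNIV) (\<lambda>\<omega>. (I 1 1 \<omega>, I 2 1 \<omega>, I 0 1 \<omega>)) = measure_pmf \<iota>"
      "distr M (count_space UNIV) (Y 1 1) = measure_pmf q1"
      "distr M (count_space UNIV) (Y 2 1) = measure_pmf q2"
      "distr M (count_space UNIV) (\<lambda>\<omega>. (Y 3 1 \<omega>, Y 4 1 \<omega>)) = measure_pmf q34"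
  shows "walk M (thinned_law p (claim_law (map_pmf step_of_mark \<iota>) q1 q2 q34))
    (\<lambda>t \<omega>. (\<Sum>n=0..t. indicator (A n) \<omega> * (I 1 n \<omega> * Y 1 n \<omega> + I 0 n \<omega> * Y 3 n \<omega>),
            \<Sum>n=0..t. indicator (A n) \<omega> * (I 2 n \<omega> * Y 2 n \<omega> + I 0 n \<omega> * Y 4 n \<omega>)))"
    (is "walk M _ ?S")
proof -
  have iid: "iid M (\<lambda>i. indicator (A i) :: 'a \<Rightarrow> int)"
    using A by (simp add: bernoulli_events_def)
  have S: "?S t \<omega> = (\<Sum>i=1..t. scale_claim (indicator (A i) \<omega>) (marked_claim I Y i \<omega>))"
    if "\<omega> \<in> space M" for t \<omega>
    by (rule sum_marked_claim[OF Y that])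
  show ?thesis
  proof (rule walk_marked[OF ind sigma_algebra_gen_sigma
        iid_steps_iid[OF iid bernoulli_events_law[OF A]] Y I laws, where c = "\<lambda>_. True"])
    have "(\<lambda>\<omega>. \<Sum>i=1..t. scale_claim (indicator (A i) \<omega>) (marked_claim I Y i \<omega>))
        \<in> measurable M (count_space UNIV)" for t
      using measurable_marked_claim[OF prob_space_axioms Y I] iid_measurable[OF iid]
      by (intro measurable_count_space_sum measurable_count_space_binop[where h = scale_claim]) auto
    moreover have "?S t \<in> measurable M (count_space UNIV) \<longleftrightarrow>
      (\<lambda>\<omega>. \<Sum>i=1..t. scale_claim (indicator (A i) \<omega>) (marked_claim I Y i \<omega>)) \<in> measurable M (count_space UNIV)" for t
    by (rule measurable_cong) (rule S)
  ultimately show "?S t \<in> measurable M (count_space UNIV)" for t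
      by blast
    fix n
    show "AE \<omega> in M. \<forall>t\<le>n. ?S t \<omega> =
        (\<Sum>i=1..t. scale_claim (indicator (A i) \<omega>)
          (marked_claim I Y (success_index n (\<lambda>j. True) i) \<omega>))"
      using AE_space by eventually_elim (simp only: S success_index_True, blast)
  qed
qed

section \<open>Constructing a compound binomial process with a given step law\<close>

text \<open>Every process used in the definition of type I is a walk with a thinned step law, so a
  given walk only has to be matched by one with the right \<open>p\<close> and
  \<open>\<kappa>\<close>.\<close>

lemma (in prob_space) walk_compound_binomial:
  fixes X1 X2 :: "nat \<Rightarrow> 'a \<Rightarrow> int"
  assumes ind: "mutually_indep M [gen_sigma M UNIV N, gen_sigma M {1..} (\<lambda>n \<omega>. (X1 n \<omega>, X2 n \<omega>))]"
    and N: "binomial_process M p N"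
    and X: "iid M (\<lambda>n \<omega>. (X1 n \<omega>, X2 n \<omega>))"
    and \<kappa>: "distr M (count_space UNIV) (\<lambda>\<omega>. (X1 1 \<omega>, X2 1 \<omega>)) = measure_pmf \<kappa>"
  shows "walk M (thinned_law p \<kappa>) (\<lambda>t \<omega>. (\<Sum>n=1..N t \<omega>. X1 n \<omega>, \<Sum>n=1..N t \<omega>. X2 n \<omega>))"
  unfolding thinned_law_def
proof (rule walkI[OF _ _ order.refl])
  let ?X = "\<lambda>n \<omega>. (X1 n \<omega>, X2 n \<omega>)"
  let ?D = "\<lambda>i \<omega>. int (N i \<omega>) - int (N (i - 1) \<omega>)"
  let ?k = "\<lambda>n \<omega>. success_index n (\<lambda>j. ?D j \<omega> = 1)"
  show "(\<lambda>\<omega>. (\<Sum>n=1..N t \<omega>. X1 n \<omega>, \<Sum>n=1..N t \<omega>. X2 n \<omega>)) \<in> measurable M (count_space UNIV)" for t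
    using N iid_measurable[OF X] unfolding sum_prod[symmetric]
    by (intro measurable_count_space_random_sum) (auto simp: binomial_process_def)
  fix n
  have "indep_steps M [gen_sigma M {1..} ?X] n ?D (bernoulli_int p)"
    unfolding indep_steps_def
    using ind binomial_process_steps[OF N] sigma_algebra_gen_sigma by blast
  from indep_steps_extend[OF this _ X \<kappa>, of "\<lambda>b. b = 1"]
  have "indep_steps M [] n (\<lambda>i \<omega>. (?D i \<omega>, ?X (?k n \<omega> i) \<omega>))
      (pair_pmf (bernoulli_int p) \<kappa>)"
    by simp
  then show "iid_steps M events n (\<lambda>i \<omega>. (?D i \<omega>, ?X (?k n \<omega> i) \<omega>))
      (pair_pmf (bernoulli_int p) \<kappa>)"
    by (rule indep_steps_iid_steps)
  show "AE \<omega> in M. \<forall>t\<le>n. (\<Sum>n=1..N t \<omega>. X1 n \<omega>, \<Sum>n=1..N t \<omega>. X2 n \<omega>) =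
      (\<Sum>i=1..t. (\<lambda>(b, x). scale_claim b x) (?D i \<omega>, ?X (?k n \<omega> i) \<omega>))"
    using binomial_process_path[OF N, of n ?X] by (simp only: sum_prod case_prod_conv)
qed

lemma (in prob_space) mutually_indep_pair:
  assumes "indep_set F G"
  shows "mutually_indep M [F, G]"
  unfolding mutually_indep_def
proof (intro indep_setsI)
  have ev: "F \<subseteq> events" "G \<subseteq> events"
    and prod: "\<And>a b. a \<in> F \<Longrightarrow> b \<in> G \<Longrightarrow> prob (a \<inter> b) = prob a * prob b"
    using assms by (auto simp: indep_sets2_eq)
  show "[F, G] ! i \<subseteq> events" if "i \<in> {..<length [F, G]}" for i
    using ev that by (auto simp: less_Suc_eq)
  fix A J
  assume J: "J \<noteq> {}" "J \<subseteq> {..<length [F, G]}" and A: "\<forall>j\<in>J. A j \<in> [F, G] ! j"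
  have "J \<subseteq> {0, 1}"
    using J(2) by (auto simp: less_Suc_eq)
  with J(1) consider "J = {0}" | "J = {1}" | "J = {0, 1}"
    by blast
  then show "prob (\<Inter>j\<in>J. A j) = (\<Prod>j\<in>J. prob (A j))"
    by cases (use A prod in auto)
qed

lemma (in prob_space) PiM_iid:
  fixes X :: "nat \<Rightarrow> 'a \<Rightarrow> 'v"
  assumes meas: "\<And>i. X i \<in> measurable M (count_space UNIV)"
    and law: "distr M (\<Pi>\<^sub>M i\<in>UNIV. count_space UNIV) (\<lambda>\<omega> i. X i \<omega>) = (\<Pi>\<^sub>M i\<in>UNIV. measure_pmf q)"
  shows "distr M (count_space UNIV) (X i) = measure_pmf q" and "iid M X"
proof -
  show X: "distr M (count_space UNIV) (X i) = measure_pmf q" for i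
  proof -
    have Xm: "(\<lambda>\<omega> i. X i \<omega>) \<in> measurable M (\<Pi>\<^sub>M i\<in>UNIV. count_space UNIV)"
      using measurable_restrict[of UNIV X M "\<lambda>_. count_space UNIV"] meas
      by (simp add: restrict_UNIV)
    have "distr M (count_space UNIV) (X i) =
        distr (distr M (\<Pi>\<^sub>M i\<in>UNIV. count_space UNIV) (\<lambda>\<omega> i. X i \<omega>)) (count_space UNIV) (\<lambda>z. z i)"
      using Xm by (subst distr_distr) (auto simp: comp_def)
    also have "\<dots> = distr (\<Pi>\<^sub>M i\<in>UNIV. measure_pmf q) (measure_pmf q) (\<lambda>z. z i)"
      unfolding law by (rule distr_cong) auto
    also have "\<dots> = measure_pmf q"
      by (rule distr_PiM_component) (auto intro: measure_pmf.prob_space_axioms)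
    finally show ?thesis .
  qed
  have "indep_vars (\<lambda>_. count_space UNIV) X UNIV"
    using law meas X by (subst indep_vars_iff_distr_eq_PiM') (auto simp: restrict_UNIV)
  then have "indep_vars (\<lambda>_. count_space UNIV) X {1..}"
    by (rule indep_vars_subset) simp
  then show "iid M X"
    by (simp add: iid_def X)
qed

text \<open>The law of the sum depends only on the step law, so it may be computed on a space of
  coin tosses, where the number of successes is known to be binomial.\<close>

lemma (in prob_space) distr_sum_bernoulli:
  assumes Z: "iid_steps M events n Z (map_pmf of_bool (bernoulli_pmf p) :: nat pmf)"
    and p: "p \<in> {0..1}"
  shows "distr M (count_space UNIV) (\<lambda>\<omega>. \<Sum>i=1..n. Z i \<omega>) = measure_pmf (binomial_pmf n p)"
proof -
  let ?P = "Pi_pmf {1..n} False (\<lambda>_. bernoulli_pmf p)"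
  let ?w = "map_pmf of_bool (bernoulli_pmf p) :: nat pmf"
  let ?g = "\<lambda>z :: nat \<Rightarrow> nat. \<Sum>i=1..n. z i"
  have P: "iid_steps (measure_pmf ?P) (sets (measure_pmf ?P)) n (\<lambda>i f. of_bool (f i)) ?w"
    unfolding iid_steps_def
  proof (intro conjI ballI allI)
    fix x :: "nat \<Rightarrow> nat"
    have "{f \<in> space (measure_pmf ?P). \<forall>i\<in>{1..n}. of_bool (f i) = x i} =
        Pi {1..n} (\<lambda>i. of_bool -` {x i})"
      by (simp add: Pi_def Ball_def)
    then show "measure_pmf.prob ?P {f \<in> space (measure_pmf ?P). \<forall>i\<in>{1..n}. of_bool (f i) = x i} =
        (\<Prod>i=1..n. pmf ?w (x i))"
      by (simp add: measure_Pi_pmf_Pi pmf_map)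
  qed simp
  have g: "?g z \<in> space (count_space UNIV)" for z
    by simp
  have restr: "?g (\<lambda>i\<in>{1..n}. z i) = ?g z" for z
    by (intro sum.cong) auto
  have "distr M (count_space UNIV) (\<lambda>\<omega>. \<Sum>i=1..n. Z i \<omega>) =
      distr (\<Pi>\<^sub>M i\<in>{1..n}. measure_pmf ?w) (count_space UNIV) ?g"
    using distr_fun_iid_steps(2)[where g = ?g, OF Z g] by (simp only: restr)
  also have "\<dots> = distr (measure_pmf ?P) (count_space UNIV) (\<lambda>f. \<Sum>i=1..n. of_bool (f i))"
    using measure_pmf.distr_fun_iid_steps(2)[where g = ?g, OF P g] by (simp only: restr)
  also have "(\<lambda>f. \<Sum>i=1..n. of_bool (f i)) = (\<lambda>f. card {i \<in> {1..n}. f i})"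
    by (auto simp: fun_eq_iff Int_def)
  also have "distr (measure_pmf ?P) (count_space UNIV) (\<lambda>f. card {i \<in> {1..n}. f i}) =
      measure_pmf (binomial_pmf n p)"
    using binomial_pmf_altdef'[of "{1..n}" n p False] p by (simp add: map_pmf_rep_eq)
  finally show ?thesis .
qed

text \<open>Increments over disjoint time blocks are functions of disjoint groups of tosses, hence
  independent. Shifting the tosses by \<open>s\<close> is an injective reindexing, which leaves
  their law unchanged and gives stationarity.\<close>

lemma (in prob_space) binomial_process_sum:
  fixes b :: "nat \<Rightarrow> 'a \<Rightarrow> nat"
  assumes b: "iid M b" and p: "p \<in> {0..1}"
    and law: "distr M (count_space UNIV) (b 1) = measure_pmf (map_pmf of_bool (bernoulli_pmf p))"
  shows "binomial_process M p (\<lambda>t \<omega>. \<Sum>i=1..t. b i \<omega>)"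
proof -
  let ?N = "\<lambda>t \<omega>. \<Sum>i=1..t. b i \<omega>"
  have bm: "b i \<in> measurable M (count_space UNIV)" if "i \<ge> 1" for i
    using iid_measurable[OF b that] .
  have events: "gen_sigma M {1..} b \<subseteq> events"
    by (rule gen_sigma_events) (simp add: bm)
  have incr: "int (?N t \<omega>) - int (?N s \<omega>) = (\<Sum>i\<in>{s<..t}. int (b i \<omega>))" if "s \<le> t" for s t \<omega>
  proof -
    have "{1..t} = {1..s} \<union> {s<..t}"
      using that by auto
    then have "?N t \<omega> = (\<Sum>i\<in>{1..s} \<union> {s<..t}. b i \<omega>)"
      by (simp only:)
    also have "\<dots> = ?N s \<omega> + (\<Sum>i\<in>{s<..t}. b i \<omega>)"
      by (rule sum.union_disjoint) auto
    finally show ?thesis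
      by simp
  qed
  have "independent_increments M (\<lambda>t \<omega>. int (?N t \<omega>))"
    unfolding independent_increments_def
  proof (intro allI impI)
    fix n and t :: "nat \<Rightarrow> nat" assume t: "strict_mono t"
    let ?K = "\<lambda>k. {t k<..t (Suc k)}"
    have "indep_vars (\<lambda>_. count_space UNIV) b {1..}"
      using b by (simp add: iid_def)
    then have "indep_vars (\<lambda>k. \<Pi>\<^sub>M i\<in>?K k. count_space UNIV) (\<lambda>k \<omega>. \<lambda>i\<in>?K k. b i \<omega>) {..<n}"
    proof (rule indep_vars_restrict)
      have "?K k \<inter> ?K l = {}" if "k < l" for k l
        using strict_mono_less_eq[OF t, of "Suc k" l] that by auto
      then show "disjoint_family_on ?K {..<n}"
        unfolding disjoint_family_on_def by (metis Int_commute linorder_neqE_nat)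
    qed auto
    then have "indep_vars (\<lambda>_. count_space UNIV)
        (\<lambda>k \<omega>. \<Sum>i\<in>?K k. int ((\<lambda>i\<in>?K k. b i \<omega>) i)) {..<n}"
      by (rule indep_vars_compose2) (intro measurable_count_space_sum, measurable)
    then show "indep_vars (\<lambda>_. count_space UNIV)
        (\<lambda>k \<omega>. int (?N (t (Suc k)) \<omega>) - int (?N (t k) \<omega>)) {..<n}"
      using incr[OF strict_mono_leD[OF t]] by simp
  qed
  moreover have "stationary_increments M (\<lambda>t \<omega>. int (?N t \<omega>))"
    unfolding stationary_increments_def
  proof (intro allI)
    fix s t
    let ?g = "\<lambda>z :: nat \<Rightarrow> nat. int (\<Sum>i=1..t. z i)"
    have g: "?g z \<in> space (count_space UNIV)" for z
      by simp
    have restr: "?g (\<lambda>i\<in>{1..t}. z i) = ?g z" for z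
      by simp
    have D: "distr M (count_space UNIV) (\<lambda>\<omega>. ?g (\<lambda>i. b (s + i) \<omega>)) =
        distr (\<Pi>\<^sub>M i\<in>{1..t}. measure_pmf (map_pmf of_bool (bernoulli_pmf p))) (count_space UNIV) ?g"
      for s
    proof -
      have "iid_steps M (gen_sigma M {1..} b) t (\<lambda>i. b (s + i)) (map_pmf of_bool (bernoulli_pmf p))"
        by (rule iid_steps_reindex[OF b law]) auto
      from distr_fun_iid_steps(2)[where g = ?g, OF iid_steps_mono[OF this events] g]
      show ?thesis
        by (simp only: restr)
    qed
    have shift: "int (?N (u + t) \<omega>) - int (?N u \<omega>) = ?g (\<lambda>i. b (u + i) \<omega>)" for u \<omega>
      using incr[of u "u + t" \<omega>] sum.shift_bounds_cl_nat_ivl[of "\<lambda>i. int (b i \<omega>)" 1 u t]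
      by (simp add: add.commute atLeastSucAtMost_greaterThanAtMost)
    have shift0: "int (?N t \<omega>) - int (?N 0 \<omega>) = ?g (\<lambda>i. b (0 + i) \<omega>)" for \<omega>
      by simp
    show "distr M (count_space UNIV) (\<lambda>\<omega>. int (?N (s + t) \<omega>) - int (?N s \<omega>)) =
        distr M (count_space UNIV) (\<lambda>\<omega>. int (?N t \<omega>) - int (?N 0 \<omega>))"
      unfolding shift0 shift using D[of s] D[of 0] by (simp only:)
  qed
  moreover have "distr M (count_space UNIV) (?N t) = measure_pmf (binomial_pmf t p)" for t
    by (rule distr_sum_bernoulli[OF iid_steps_mono[OF iid_steps_iid[OF b law] events] p])
  moreover have "?N t \<in> measurable M (count_space UNIV)" for t
    by (intro measurable_count_space_sum bm) simp
  ultimately show ?thesis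
    using p by (simp add: binomial_process_def)
qed

text \<open>A type I process has to be exhibited on the prescribed path space. The first coordinate
  carries coin tosses, whose partial sums form \<open>N\<close>, rather than the path of
  \<open>N\<close> itself; the second carries pairs with law \<open>\<kappa>\<close>. The product
  measure makes both independent, and the common step law gives the finite dimensional
  distributions.\<close>

lemma compound_binomial_of_walk:
  fixes S :: "nat \<Rightarrow> 'a \<Rightarrow> int \<times> int"
  assumes M: "prob_space M" and S: "walk M (thinned_law p \<kappa>) S" and p: "p \<in> {0..1}"
  shows "compound_binomial_type_I M S"
proof -
  define P1 :: "(nat \<Rightarrow> nat) measure"
    where "P1 = (\<Pi>\<^sub>M i\<in>UNIV. measure_pmf (map_pmf of_bool (bernoulli_pmf p)))"
  define P2 :: "(nat \<Rightarrow> int \<times> int) measure" where "P2 = (\<Pi>\<^sub>M i\<in>UNIV. measure_pmf \<kappa>)"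
  define Q where "Q = P1 \<Otimes>\<^sub>M P2"
  interpret P1: prob_space P1
    unfolding P1_def by (intro prob_space_PiM measure_pmf.prob_space_axioms)
  interpret P2: prob_space P2
    unfolding P2_def by (intro prob_space_PiM measure_pmf.prob_space_axioms)
  interpret P: pair_prob_space P1 P2 ..
  interpret Q: prob_space Q
    unfolding Q_def by (rule P.prob_space_axioms)
  have fst: "distr Q P1 fst = P1"
    unfolding Q_def by (rule P2.distr_pair_fst)
  have snd: "distr Q P2 snd = P2"
  proof -
    \<comment> \<open>Exchanging the factors reduces the second marginal to the first.\<close>
    have "distr Q P2 snd = distr (distr (P2 \<Otimes>\<^sub>M P1) Q (\<lambda>(x, y). (y, x))) P2 snd"
      unfolding Q_def using P.distr_pair_swap by simp
    also have "\<dots> = distr (P2 \<Otimes>\<^sub>M P1) P2 fst"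
      unfolding Q_def by (subst distr_distr) (auto simp: comp_def split_beta)
    also have "\<dots> = P2"
      by (rule P1.distr_pair_fst)
    finally show ?thesis .
  qed
  have sets1: "sets P1 = sets (\<Pi>\<^sub>M i\<in>UNIV. count_space UNIV)"
    unfolding P1_def by (intro sets_PiM_cong) auto
  have sets2: "sets P2 = sets (\<Pi>\<^sub>M i\<in>UNIV. count_space UNIV)"
    unfolding P2_def by (intro sets_PiM_cong) auto
  have fst_meas[measurable]: "fst \<in> measurable Q P1" and snd_meas[measurable]: "snd \<in> measurable Q P2"
    unfolding Q_def by auto
  have coord1: "(\<lambda>z. z i) \<in> measurable P1 (count_space UNIV)" for i
    using measurable_component_singleton[of i UNIV "\<lambda>_. count_space UNIV"]
    by (simp add: measurable_cong_sets[OF sets1 refl])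
  have coord2: "(\<lambda>z. z i) \<in> measurable P2 (count_space UNIV)" for i
    using measurable_component_singleton[of i UNIV "\<lambda>_. count_space UNIV"]
    by (simp add: measurable_cong_sets[OF sets2 refl])
  let ?b = "\<lambda>i \<omega>. fst \<omega> i" and ?X = "\<lambda>n \<omega>. snd \<omega> n"
  have bm: "?b i \<in> measurable Q (count_space UNIV)" for i
    by (rule measurable_compose[OF fst_meas coord1])
  have bd: "distr Q (\<Pi>\<^sub>M i\<in>UNIV. count_space UNIV) (\<lambda>\<omega> i. ?b i \<omega>) =
      (\<Pi>\<^sub>M i\<in>UNIV. measure_pmf (map_pmf of_bool (bernoulli_pmf p)))"
  proof -
    have "distr Q (\<Pi>\<^sub>M i\<in>UNIV. count_space UNIV) (\<lambda>\<omega> i. ?b i \<omega>) = distr Q P1 fst"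
      by (rule distr_cong[OF refl sets1[symmetric]]) simp
    also have "\<dots> = P1"
      by (rule fst)
    finally show ?thesis
      by (simp only: P1_def)
  qed
  note b = Q.PiM_iid(2)[OF bm bd] Q.PiM_iid(1)[OF bm bd, of 1]
  have Xm: "?X i \<in> measurable Q (count_space UNIV)" for i
    by (rule measurable_compose[OF snd_meas coord2])
  have Xd: "distr Q (\<Pi>\<^sub>M i\<in>UNIV. count_space UNIV) (\<lambda>\<omega> i. ?X i \<omega>) =
      (\<Pi>\<^sub>M i\<in>UNIV. measure_pmf \<kappa>)"
  proof -
    have "distr Q (\<Pi>\<^sub>M i\<in>UNIV. count_space UNIV) (\<lambda>\<omega> i. ?X i \<omega>) = distr Q P2 snd"
      by (rule distr_cong[OF refl sets2[symmetric]]) simp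
    also have "\<dots> = P2"
      by (rule snd)
    finally show ?thesis
      by (simp only: P2_def)
  qed
  note X = Q.PiM_iid(2)[OF Xm Xd] Q.PiM_iid(1)[OF Xm Xd, of 1]
  let ?N = "\<lambda>t \<omega>. \<Sum>i=1..t. ?b i \<omega>"
  \<comment> \<open>Preimages under the two projections are stable under intersection, so
    independence need only be checked for one preimage of each kind; together they form a rectangle,
    where the product measure factorises.\<close>
  let ?E1 = "{fst -` A \<inter> space Q | A. A \<in> sets P1}" and ?E2 = "{snd -` A \<inter> space Q | A. A \<in> sets P2}"
  let ?G1 = "sigma_sets (space Q) ?E1" and ?G2 = "sigma_sets (space Q) ?E2"
  have N: "binomial_process Q p ?N"
    by (rule Q.binomial_process_sum[OF b(1) p b(2)])
  have "Q.indep_set ?G1 ?G2"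
  proof (rule Q.indep_set_sigma_sets)
    show "Q.indep_set ?E1 ?E2"
    proof (rule Q.indep_setI)
      show "?E1 \<subseteq> Q.events" "?E2 \<subseteq> Q.events"
        using measurable_sets[OF fst_meas] measurable_sets[OF snd_meas] by auto
      fix a b assume "a \<in> ?E1" "b \<in> ?E2"
      then obtain A B where A: "A \<in> sets P1" "a = fst -` A \<inter> space Q"
        and B: "B \<in> sets P2" "b = snd -` B \<inter> space Q"
        by blast
      have "a \<inter> b = A \<times> B"
        using A B sets.sets_into_space[OF A(1)] sets.sets_into_space[OF B(1)]
        by (auto simp: Q_def space_pair_measure)
      then have "emeasure Q (a \<inter> b) = emeasure P1 A * emeasure P2 B"
        using A B by (simp add: Q_def P2.emeasure_pair_measure_Times)
      moreover have "emeasure P1 A = emeasure Q a" "emeasure P2 B = emeasure Q b"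
        using emeasure_distr[OF fst_meas A(1)] emeasure_distr[OF snd_meas B(1)] fst snd A B
        by simp_all
      ultimately show "Q.prob (a \<inter> b) = Q.prob a * Q.prob b"
        by (simp add: measure_def enn2real_mult)
    qed
    show "Int_stable ?E1"
    proof (rule Int_stableI)
      fix a b assume "a \<in> ?E1" "b \<in> ?E1"
      then obtain A B where "A \<in> sets P1" "a = fst -` A \<inter> space Q" "B \<in> sets P1" "b = fst -` B \<inter> space Q"
        by blast
      then show "a \<inter> b \<in> ?E1"
        by (intro CollectI exI[of _ "A \<inter> B"]) auto
    qed
    show "Int_stable ?E2"
    proof (rule Int_stableI)
      fix a b assume "a \<in> ?E2" "b \<in> ?E2"
      then obtain A B where "A \<in> sets P2" "a = snd -` A \<inter> space Q" "B \<in> sets P2" "b = snd -` B \<inter> space Q"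
        by blast
      then show "a \<inter> b \<in> ?E2"
        by (intro CollectI exI[of _ "A \<inter> B"]) auto
    qed
  qed
  then have indG: "mutually_indep Q [?G1, ?G2]"
    by (rule Q.mutually_indep_pair)
  have G1: "gen_sigma Q UNIV ?N \<subseteq> ?G1"
  proof (rule gen_sigma_least)
    fix t C
    have "(\<lambda>z. \<Sum>i=1..t. z i) \<in> measurable P1 (count_space UNIV)"
      by (intro measurable_count_space_sum coord1)
    from measurable_sets[OF this, of C]
    have "(\<lambda>z. \<Sum>i=1..t. z i) -` C \<inter> space P1 \<in> sets P1"
      by simp
    moreover have "{\<omega> \<in> space Q. ?N t \<omega> \<in> C} =
        fst -` ((\<lambda>z. \<Sum>i=1..t. z i) -` C \<inter> space P1) \<inter> space Q"
      using measurable_space[OF fst_meas] by auto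
    ultimately show "{\<omega> \<in> space Q. ?N t \<omega> \<in> C} \<in> ?G1"
      by (intro sigma_sets.Basic) blast
  qed (rule sigma_algebra_sigma_sets, auto)
  have G2: "gen_sigma Q {1..} ?X \<subseteq> ?G2"
  proof (rule gen_sigma_least)
    fix i C
    have "(\<lambda>z. z i) -` C \<inter> space P2 \<in> sets P2"
      by (rule measurable_sets[OF coord2]) simp
    moreover have "{\<omega> \<in> space Q. ?X i \<omega> \<in> C} = snd -` ((\<lambda>z. z i) -` C \<inter> space P2) \<inter> space Q"
      using measurable_space[OF snd_meas] by auto
    ultimately show "{\<omega> \<in> space Q. ?X i \<omega> \<in> C} \<in> ?G2"
      by (intro sigma_sets.Basic) blast
  qed (rule sigma_algebra_sigma_sets, auto)
  have ind: "mutually_indep Q [gen_sigma Q UNIV ?N, gen_sigma Q {1..} ?X]"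
  proof (rule Q.mutually_indep_reindex[OF indG, where f = "\<lambda>k. k"])
    fix k assume "k < length [gen_sigma Q UNIV ?N, gen_sigma Q {1..} ?X]"
    then consider "k = 0" | "k = 1"
      by fastforce
    then show "k < length [?G1, ?G2] \<and> [gen_sigma Q UNIV ?N, gen_sigma Q {1..} ?X] ! k \<subseteq> [?G1, ?G2] ! k"
    proof cases
      case 1
      show ?thesis
        unfolding 1 nth_Cons_0 using G1 by (simp only: list.size) simp
    next
      case 2
      show ?thesis
        unfolding 2 One_nat_def nth_Cons_Suc nth_Cons_0 using G2 by (simp only: list.size) simp
    qed
  qed simp
  define X1 X2 :: "nat \<Rightarrow> (nat \<Rightarrow> nat) \<times> (nat \<Rightarrow> int \<times> int) \<Rightarrow> int" where "X1 = (\<lambda>n \<omega>. fst (?X n \<omega>))" and "X2 = (\<lambda>n \<omega>. snd (?X n \<omega>))"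
  have X12: "(\<lambda>n \<omega>. (X1 n \<omega>, X2 n \<omega>)) = ?X"
    by (simp add: X1_def X2_def)
  have X12_1: "(\<lambda>\<omega>. (X1 1 \<omega>, X2 1 \<omega>)) = ?X 1"
    by (simp add: X1_def X2_def)
  have "walk Q (thinned_law p \<kappa>) (\<lambda>t \<omega>. (\<Sum>n=1..?N t \<omega>. X1 n \<omega>, \<Sum>n=1..?N t \<omega>. X2 n \<omega>))"
    by (rule Q.walk_compound_binomial[OF ind[folded X12] N X(1)[folded X12] X(2)[folded X12_1]])
  from walk_same_fdd[OF M S Q.prob_space_axioms this]
  show ?thesis
    unfolding compound_binomial_type_I_def
    using Q.prob_space_axioms N X(1)[folded X12] ind[folded X12] by blast
qed

section \<open>Mark laws and the comparison of the three processes\<close>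

text \<open>That the original process is of type I involves no given indicator vectors, so a mark
  law must be produced in order to split its step law.\<close>

lemma mark_probs_exists:
  assumes "0 \<le> p0" "0 \<le> p1" "0 \<le> p2" "0 < p0 + p1 + p2"
  obtains \<iota> where "mark_probs p0 p1 p2 \<iota>"
proof -
  let ?l = "[((1, 0, 0), p1 / (p0 + p1 + p2)), ((0, 1, 0), p2 / (p0 + p1 + p2)),
    ((0, 0, 1), p0 / (p0 + p1 + p2))] :: ((int \<times> int \<times> int) \<times> real) list"
  have "p1 / (p0 + p1 + p2) + (p2 / (p0 + p1 + p2) + p0 / (p0 + p1 + p2)) = 1"
    using assms by (simp flip: add_divide_distrib)
  then have "pmf_of_list_wf ?l"
    using assms by (intro pmf_of_list_wfI) auto
  then have "mark_probs p0 p1 p2 (pmf_of_list ?l)"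
    by (simp add: mark_probs_def pmf_pmf_of_list)
  then show thesis
    by (rule that)
qed

lemma (in prob_space) indicator_vectors_law:
  assumes I: "indicator_vectors M p0 p1 p2 I"
  obtains \<iota> where "distr M (count_space UNIV) (\<lambda>\<omega>. (I 1 1 \<omega>, I 2 1 \<omega>, I 0 1 \<omega>)) = measure_pmf \<iota>"
    and "mark_probs p0 p1 p2 \<iota>"
proof -
  have iid: "iid M (\<lambda>i \<omega>. (I 1 i \<omega>, I 2 i \<omega>, I 0 i \<omega>))"
    using I by (simp add: indicator_vectors_def)
  note meas = iid_measurable[OF iid order.refl]
  obtain \<iota> where \<iota>: "distr M (count_space UNIV) (\<lambda>\<omega>. (I 1 1 \<omega>, I 2 1 \<omega>, I 0 1 \<omega>)) = measure_pmf \<iota>"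
    using distr_eq_pmf[OF meas] .
  have "mark_probs p0 p1 p2 \<iota>"
    unfolding mark_probs_def pmf_eq_prob[OF meas \<iota>] using I by (simp only: indicator_vectors_def)
  with \<iota> show thesis
    by (rule that)
qed

text \<open>The comparison processes live on a space \<open>M'\<close> of their own, with claims
  that share only their laws with \<open>Y\<close>; a common space is the case \<open>M' = M\<close>
  and \<open>Y' = Y\<close>.\<close>

theorem theorem2:
  fixes M :: "'a measure"
    and p0 p1 p2 p :: real
    and B0 B1 B2 :: "nat \<Rightarrow> 'a \<Rightarrow> nat"
    and Y :: "nat \<Rightarrow> nat \<Rightarrow> 'a \<Rightarrow> int"
    and S1 S2 :: "nat \<Rightarrow> 'a \<Rightarrow> int"
  assumes "prob_space M"
    and "0 \<le> p0" and "0 \<le> p1" and "0 \<le> p2"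
    and "p = p0 + p1 + p2" and "0 < p" and "p \<le> 1"
    and "multinomial_process M p0 p1 p2 B0 B1 B2"
    and "claim_sizes M Y"
    and "mutually_indep M
           [gen_sigma M UNIV (\<lambda>t \<omega>. (B0 t \<omega>, B1 t \<omega>, B2 t \<omega>)),
            gen_sigma M {1..} (Y 1),
            gen_sigma M {1..} (Y 2),
            gen_sigma M {1..} (\<lambda>i \<omega>. (Y 3 i \<omega>, Y 4 i \<omega>))]"
    and "\<And>t \<omega>. S1 t \<omega> = (\<Sum>i=0..B1 t \<omega>. Y 1 i \<omega>) + (\<Sum>i=0..B0 t \<omega>. Y 3 i \<omega>)"
    and "\<And>t \<omega>. S2 t \<omega> = (\<Sum>i=0..B2 t \<omega>. Y 2 i \<omega>) + (\<Sum>i=0..B0 t \<omega>. Y 4 i \<omega>)"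
  shows "compound_binomial_type_I M (\<lambda>t \<omega>. (S1 t \<omega>, S2 t \<omega>)) \<and>
    (\<forall>(M' :: 'b measure) (Y' :: nat \<Rightarrow> nat \<Rightarrow> 'b \<Rightarrow> int) (I :: nat \<Rightarrow> nat \<Rightarrow> 'b \<Rightarrow> int)
        (B :: nat \<Rightarrow> 'b \<Rightarrow> nat) (A :: nat \<Rightarrow> 'b set).
      prob_space M' \<and>
      claim_sizes M' Y' \<and> same_claim_laws M Y M' Y' \<and>
      indicator_vectors M' p0 p1 p2 I \<and>
      binomial_process M' p B \<and>
      bernoulli_events M' p A \<and>
      mutually_indep M'
        [gen_sigma M' {1..} (\<lambda>i. indicator (A i) :: 'b \<Rightarrow> int),
         gen_sigma M' UNIV B,
         gen_sigma M' {1..} (Y' 1),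
         gen_sigma M' {1..} (Y' 2),
         gen_sigma M' {1..} (\<lambda>i \<omega>. (Y' 3 i \<omega>, Y' 4 i \<omega>)),
         gen_sigma M' {1..} (\<lambda>i \<omega>. (I 1 i \<omega>, I 2 i \<omega>, I 0 i \<omega>))]
      \<longrightarrow>
      same_fdd M (\<lambda>t \<omega>. (S1 t \<omega>, S2 t \<omega>)) M'
        (\<lambda>t \<omega>. (\<Sum>n=0..B t \<omega>. I 1 n \<omega> * Y' 1 n \<omega> + I 0 n \<omega> * Y' 3 n \<omega>,
                \<Sum>n=0..B t \<omega>. I 2 n \<omega> * Y' 2 n \<omega> + I 0 n \<omega> * Y' 4 n \<omega>)) \<and>
      same_fdd M (\<lambda>t \<omega>. (S1 t \<omega>, S2 t \<omega>)) M'
        (\<lambda>t \<omega>. (\<Sum>n=0..t. indicator (A n) \<omega> * (I 1 n \<omega> * Y' 1 n \<omega> + I 0 n \<omega> * Y' 3 n \<omega>),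
                \<Sum>n=0..t. indicator (A n) \<omega> * (I 2 n \<omega> * Y' 2 n \<omega> + I 0 n \<omega> * Y' 4 n \<omega>))))"
proof (intro conjI allI impI)
  note M = assms(1) and nonneg = assms(2-4) and p = assms(5-7) and B = assms(8) and Y = assms(9)
    and ind = assms(10) and S = assms(11,12)
  interpret M: prob_space M by fact
  have Bm: "B0 1 \<in> measurable M (count_space UNIV)" "B1 1 \<in> measurable M (count_space UNIV)"
      "B2 1 \<in> measurable M (count_space UNIV)"
    using B by (auto simp: multinomial_process_def)
  obtain \<delta> where \<delta>:
    "distr M (count_space UNIV) (\<lambda>\<omega>. (int (B0 1 \<omega>), int (B1 1 \<omega>), int (B2 1 \<omega>))) = measure_pmf \<delta>"
    using M.distr_eq_pmf[OF measurable_int_triple[OF Bm]] .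
  have iid_Y: "iid M (Y 1)" "iid M (Y 2)" "iid M (\<lambda>i \<omega>. (Y 3 i \<omega>, Y 4 i \<omega>))"
    using Y by (auto simp: claim_sizes_def)
  obtain q1 where q1: "distr M (count_space UNIV) (Y 1 1) = measure_pmf q1"
    using M.distr_eq_pmf[OF M.iid_measurable[OF iid_Y(1) order.refl]] .
  obtain q2 where q2: "distr M (count_space UNIV) (Y 2 1) = measure_pmf q2"
    using M.distr_eq_pmf[OF M.iid_measurable[OF iid_Y(2) order.refl]] .
  obtain q34 where q34: "distr M (count_space UNIV) (\<lambda>\<omega>. (Y 3 1 \<omega>, Y 4 1 \<omega>)) = measure_pmf q34"
    using M.distr_eq_pmf[OF M.iid_measurable[OF iid_Y(3) order.refl]] .
  have walk: "walk M (claim_law \<delta> q1 q2 q34) (\<lambda>t \<omega>. (S1 t \<omega>, S2 t \<omega>))"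
    by (rule M.walk_multinomial[OF B Y ind S \<delta> q1 q2 q34])
  have law: "claim_law \<delta> q1 q2 q34 = thinned_law p (claim_law (map_pmf step_of_mark \<iota>) q1 q2 q34)"
    if "mark_probs p0 p1 p2 \<iota>" for \<iota>
    by (rule claim_law_mixture[OF multinomial_step_mixture[OF that p]])
      (rule M.multinomial_step_law[OF B \<delta>])
  obtain \<iota> where "mark_probs p0 p1 p2 \<iota>"
    using mark_probs_exists nonneg p by metis
  from compound_binomial_of_walk[OF M walk[unfolded law[OF this]]] p
  show "compound_binomial_type_I M (\<lambda>t \<omega>. (S1 t \<omega>, S2 t \<omega>))"
    by simp
  fix M' :: "'b measure" and Y' I :: "nat \<Rightarrow> nat \<Rightarrow> 'b \<Rightarrow> int" and B :: "nat \<Rightarrow> 'b \<Rightarrow> nat"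
    and A :: "nat \<Rightarrow> 'b set"
  let ?A = "gen_sigma M' {1..} (\<lambda>i. indicator (A i) :: 'b \<Rightarrow> int)"
  let ?I = "gen_sigma M' {1..} (\<lambda>i \<omega>. (I 1 i \<omega>, I 2 i \<omega>, I 0 i \<omega>))"
  let ?Y = "[gen_sigma M' {1..} (Y' 1), gen_sigma M' {1..} (Y' 2),
    gen_sigma M' {1..} (\<lambda>i \<omega>. (Y' 3 i \<omega>, Y' 4 i \<omega>))]"
  assume "prob_space M' \<and>
      claim_sizes M' Y' \<and> same_claim_laws M Y M' Y' \<and>
      indicator_vectors M' p0 p1 p2 I \<and>
      binomial_process M' p B \<and>
      bernoulli_events M' p A \<and>
      mutually_indep M'
        [gen_sigma M' {1..} (\<lambda>i. indicator (A i) :: 'b \<Rightarrow> int),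
         gen_sigma M' UNIV B,
         gen_sigma M' {1..} (Y' 1),
         gen_sigma M' {1..} (Y' 2),
         gen_sigma M' {1..} (\<lambda>i \<omega>. (Y' 3 i \<omega>, Y' 4 i \<omega>)),
         gen_sigma M' {1..} (\<lambda>i \<omega>. (I 1 i \<omega>, I 2 i \<omega>, I 0 i \<omega>))]"
  then have M': "prob_space M'" and Y': "claim_sizes M' Y'" and same: "same_claim_laws M Y M' Y'"
    and I: "indicator_vectors M' p0 p1 p2 I" and B': "binomial_process M' p B"
    and A: "bernoulli_events M' p A"
    and ind': "mutually_indep M' (?A # gen_sigma M' UNIV B # ?Y @ [?I])"
    by auto
  interpret M': prob_space M' by fact
  \<comment> \<open>The list of positions omits the events \<open>A\<close> (position 0) and moves
    the marks (position 5) directly behind \<open>B\<close> (position 1); for \<open>indA\<close> it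
    is \<open>B\<close> that is omitted.\<close>
  have indB: "mutually_indep M' (gen_sigma M' UNIV B # ?I # ?Y)"
    by (rule M'.mutually_indep_reindex[OF ind', where f = "\<lambda>k. [1, 5, 2, 3, 4] ! k"])
      (auto simp: inj_on_def less_Suc_eq)
  have indA: "mutually_indep M' (?A # ?I # ?Y)"
    by (rule M'.mutually_indep_reindex[OF ind', where f = "\<lambda>k. [0, 5, 2, 3, 4] ! k"])
      (auto simp: inj_on_def less_Suc_eq)
  obtain \<iota> where \<iota>:
    "distr M' (count_space UNIV) (\<lambda>\<omega>. (I 1 1 \<omega>, I 2 1 \<omega>, I 0 1 \<omega>)) = measure_pmf \<iota>"
    "mark_probs p0 p1 p2 \<iota>"
    using M'.indicator_vectors_law[OF I] .
  have iid_I: "iid M' (\<lambda>i \<omega>. (I 1 i \<omega>, I 2 i \<omega>, I 0 i \<omega>))"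
    using I by (simp add: indicator_vectors_def)
  \<comment> \<open>The same pmfs describe the claims on both spaces, so the step laws of the walks
    on \<open>M\<close> and \<open>M'\<close> can be compared as pmfs.\<close>
  have laws: "distr M' (count_space UNIV) (Y' 1 1) = measure_pmf q1"
    "distr M' (count_space UNIV) (Y' 2 1) = measure_pmf q2"
    "distr M' (count_space UNIV) (\<lambda>\<omega>. (Y' 3 1 \<omega>, Y' 4 1 \<omega>)) = measure_pmf q34"
    using same q1 q2 q34 by (simp_all add: same_claim_laws_def)
  show "same_fdd M (\<lambda>t \<omega>. (S1 t \<omega>, S2 t \<omega>)) M'
        (\<lambda>t \<omega>. (\<Sum>n=0..B t \<omega>. I 1 n \<omega> * Y' 1 n \<omega> + I 0 n \<omega> * Y' 3 n \<omega>,
                \<Sum>n=0..B t \<omega>. I 2 n \<omega> * Y' 2 n \<omega> + I 0 n \<omega> * Y' 4 n \<omega>))"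
    by (rule walk_same_fdd[OF M walk[unfolded law[OF \<iota>(2)]] M'
          M'.walk_binomial_marked[OF indB B' Y' iid_I \<iota>(1) laws]])
  show "same_fdd M (\<lambda>t \<omega>. (S1 t \<omega>, S2 t \<omega>)) M'
        (\<lambda>t \<omega>. (\<Sum>n=0..t. indicator (A n) \<omega> * (I 1 n \<omega> * Y' 1 n \<omega> + I 0 n \<omega> * Y' 3 n \<omega>),
                \<Sum>n=0..t. indicator (A n) \<omega> * (I 2 n \<omega> * Y' 2 n \<omega> + I 0 n \<omega> * Y' 4 n \<omega>)))"
    by (rule walk_same_fdd[OF M walk[unfolded law[OF \<iota>(2)]] M'
          M'.walk_bernoulli_marked[OF indA A Y' iid_I \<iota>(1) laws]])
qed

end
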